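(* Suppose the dynamics has the form $f(x,u)=f_{\mathsf d}(x)+F_{\mathsf c}(x)\varphi(u)$ and the reward the form $r(x,u)=\mathfrak r(x)-\mathfrak c(\varphi(u))$, where $f_{\mathsf d}:\mathcal X\to\mathcal X$, $F_{\mathsf c}:\mathcal X\to\mathbb R^{l\times m}$, $\mathfrak r:\mathcal X\to\mathbb R$ are continuous; $\varphi:\mathcal U\to\mathcal A$ is a continuous function from the action space $\mathcal U$ to another action space $\mathcal A\subseteq\mathbb R^m$ that has an inverse $\varphi^{-1}:\mathcal A^{\mathrm o}\to\mathcal U^{\mathrm o}$ between the interiors; and $\mathfrak c:\mathcal A\to\mathbb R$ is strictly convex and $\mathrm C^1$ with surjective gradient $\nabla\mathfrak c(\mathcal A^{\mathrm o})=\mathbb R^{1\times m}$. Let $\sigma=(\nabla\mathfrak c^{\mathsf T})^{-1}:\mathbb R^m\to\mathcal A^{\mathrm o}$ and $\tilde\sigma(\mathfrak u)=\varphi^{-1}[\sigma(\mathfrak u)]$ for $\mathfrak u\in\mathbb R^m$. Then: (a) for each admissible policy $\pi$, a maximal policy $\pi'$ over $\pi$ is explicitly given by $\pi'(x)=\tilde\sigma\big(F_{\mathsf c}^{\mathsf T}(x)\nabla v_\pi^{\mathsf T}(x)\big)$; (b) let $\langle v_i\rangle_{i\ge1}$, $\langle\pi_i\rangle_{i\ge0}$ be generated by DPI or by IPI, starting from an admissible policy $\pi_0$, with policy improvement performed by $\pi_i(x)=\tilde\sigma\big(F_{\mathsf c}^{\mathsf T}(x)\nabla v_i^{\mathsf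 T}(x)\big)$ and under the boundary condition that, for every $i\in\mathbb N$, if $\pi_{i-1}$ is admissible then $\lim_{t\to\infty}\mathbb G_{\pi_{i-1}}^x[\gamma^tv_i(X_t)]=0$ for all $x\in\mathcal X$. If $\langle\nabla v_i\rangle$ converges locally uniformly, then $v_*=\hat v_*$, where $\hat v_*(x)=\sup_{i\in\mathbb N}v_i(x)$, is a solution of the Hamilton–Jacobi–Bellman equation $\alpha v_*(x)=\max_{u\in\mathcal U}h(x,u,\nabla v_*(x))$ for all $x\in\mathcal X$, such that $v_*\in\mathrm C^1$ and $v_i\to v_*$, $\nabla v_i\to\nabla v_*$, and $\pi_i\to\pi_*$, all locally uniformly, where $\pi_*(x)=\tilde\sigma\big(F_{\mathsf c}^{\mathsf T}(x)\nabla v_*^{\mathsf T}(x)\big)$.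
   Context: State space $\mathcal X=\mathbb R^l$, $\mathcal X^{\mathsf T}=\mathbb R^{1\times l}$, time space $\mathbb T=[0,\infty)$. An action space ($\mathcal U$ or $\mathcal A$) is an $m$-dimensional manifold in $\mathbb R^m$ with or without boundary, meaning a set of the form $O\cup\partial O$ or $O$ for some open $O\subseteq\mathbb R^m$; superscript $\mathrm o$ denotes interior. The environment is $\dot X_t=f(X_t,U_t)$, with $f:\mathcal X\times\mathcal U\to\mathcal X$ continuous and $t\mapsto U_t\in\mathcal U$ continuous; it is a standing assumption that the state trajectory $t\mapsto X_t$ is uniquely defined over all of $\mathbb T$ (for every initial state, in particular under every policy). A policy is a continuous function $\pi:\mathcal X\to\mathcal U$. $\mathbb G_\pi^x[Y]$ denotes the value of $Y$ when $X_0=x$ and $U_t=\pi(X_t)$ for all $t\in\mathbb T$. The reward function $r:\mathcal X\times\mathcal U\to\mathbb R$ is continuous, $R_t=r(X_t,U_t)$; $\gamma\in(0,1]$ is the discount factor and $\alpha=-\ln\gamma\ge0$. Standing assumption: $r$ attains a maximum $r_{\mathsf{max}}$, and $r_{\mathsf{max}}=0$ if $\gamma=1$. The value function (VF) of $\pi$ is $v_\pi(x)=\mathbb G_\pi^x[\int_0^\infty\gamma^tR_t\,dt]\in[-\infty,\infty)$. A policy $\pi$ is admissible iff $v_\pi(x)$ is finite for all $x\in\mathcal X$. Standing assumption: at least one admissible policy exists, and every admissible VF is $\mathrm C^1$. Gradients are row vectors, and the Hamiltonian is $h(x,u,p)=r(x,u)+p\,f(x,u)$. A maximal policy over an admissible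 $\pi$ is a policy $\pi'$ with $\pi'(x)\in\arg\max_{u\in\mathcal U}h(x,u,\nabla v_\pi(x))$ for all $x$. A function on a set is $\mathrm C^1$ iff its first-order partial derivatives exist and are continuous over the interior of the set; strict convexity of $\mathfrak c$ on $\mathcal A$ includes convexity of $\mathcal A$. Under the hypotheses on $\mathfrak c$, $\nabla\mathfrak c^{\mathsf T}:\mathcal A^{\mathrm o}\to\mathbb R^m$ is bijective, so $\sigma$ is well defined. DPI (differential policy iteration): given $\pi_0$, for $i=1,2,\dots$: (evaluation) $v_i:\mathcal X\to\mathbb R$ is a $\mathrm C^1$ function with $\alpha v_i(x)=h(x,\pi_{i-1}(x),\nabla v_i(x))$ for all $x$; (improvement) here as in (b). IPI (integral policy iteration): the same except that, for a fixed $\eta>0$, evaluation requires a $\mathrm C^1$ function $v_i$ with $v_i(x)=\mathbb G_{\pi_{i-1}}^x[\int_0^\eta\gamma^tR_t\,dt+\gamma^\eta v_i(X_\eta)]$ for all $x$. Locally uniform convergence means each $x\in\mathcal X$ has a neighborhood on which convergence is uniform. *)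

theory Defs
  imports "HOL-Analysis.Analysis"
begin

text \<open>
  States live in \<^typ>\<open>real ^ 'l\<close>, actions in subsets of \<^typ>\<open>real ^ 'm\<close>.  Row vectors
  (gradients) are represented by the same vector types; the product of a row vector with a
  column vector is the inner product.  The dynamics \<open>f\<close>, the reward \<open>r\<close> and policies are
  total functions, but only their values at actions in \<open>U\<close> are ever constrained or used.
\<close>

definition action_space :: "(real ^ 'm) set \<Rightarrow> bool" where
  "action_space S \<longleftrightarrow> (\<exists>G. open G \<and> (S = G \<or> S = G \<union> frontier G))"

definition partial_deriv :: "'n \<Rightarrow> (real ^ 'n \<Rightarrow> real) \<Rightarrow> real ^ 'n \<Rightarrow> real" where
  "partial_deriv i g x = deriv (\<lambda>s. g (x + s *\<^sub>R axis i 1)) 0"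

definition gradient :: "(real ^ 'n \<Rightarrow> real) \<Rightarrow> real ^ 'n \<Rightarrow> real ^ 'n" where
  "gradient g x = (\<chi> i. partial_deriv i g x)"

definition C1_on :: "(real ^ 'n) set \<Rightarrow> (real ^ 'n \<Rightarrow> real) \<Rightarrow> bool" where
  "C1_on S g \<longleftrightarrow>
     (\<forall>i. (\<forall>x\<in>interior S. (\<lambda>s. g (x + s *\<^sub>R axis i 1)) field_differentiable (at 0)) \<and>
          continuous_on (interior S) (partial_deriv i g))"

definition strictly_convex_on :: "(real ^ 'n) set \<Rightarrow> (real ^ 'n \<Rightarrow> real) \<Rightarrow> bool" where
  "strictly_convex_on S g \<longleftrightarrow> convex S \<and>
     (\<forall>x\<in>S. \<forall>y\<in>S. \<forall>t. x \<noteq> y \<longrightarrow> 0 < t \<longrightarrow> t < 1 \<longrightarrow>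
        g ((1 - t) *\<^sub>R x + t *\<^sub>R y) < (1 - t) * g x + t * g y)"

definition attains_max :: "('a \<Rightarrow> real) \<Rightarrow> 'a set \<Rightarrow> real \<Rightarrow> bool" where
  "attains_max g S M \<longleftrightarrow> (\<exists>u\<in>S. g u = M) \<and> (\<forall>u\<in>S. g u \<le> M)"

definition locally_uniform_limit ::
    "(nat \<Rightarrow> 'a::topological_space \<Rightarrow> 'b::metric_space) \<Rightarrow> ('a \<Rightarrow> 'b) \<Rightarrow> bool" where
  "locally_uniform_limit F g \<longleftrightarrow>
     (\<forall>x. \<exists>N. open N \<and> x \<in> N \<and> uniform_limit N F g sequentially)"

definition is_trajectory ::
    "(real ^ 'l \<Rightarrow> real ^ 'm \<Rightarrow> real ^ 'l) \<Rightarrow> (real \<Rightarrow> real ^ 'm) \<Rightarrow> real ^ 'l \<Rightarrow> (real \<Rightarrow> real ^ 'l) \<Rightarrow> bool"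
  where
  "is_trajectory f u x X \<longleftrightarrow> X 0 = x \<and>
     (\<forall>t\<ge>0. (X has_vector_derivative f (X t) (u t)) (at t within {0..}))"

definition policy :: "(real ^ 'm) set \<Rightarrow> (real ^ 'l \<Rightarrow> real ^ 'm) \<Rightarrow> bool" where
  "policy U \<pi> \<longleftrightarrow> continuous_on UNIV \<pi> \<and> range \<pi> \<subseteq> U"

definition uniquely_defined :: "((real \<Rightarrow> real ^ 'l) \<Rightarrow> bool) \<Rightarrow> bool" where
  "uniquely_defined P \<longleftrightarrow> (\<exists>X. P X \<and> (\<forall>Y. P Y \<longrightarrow> (\<forall>t\<ge>0. Y t = X t)))"

text \<open>
  Trajectories are unique and global both for every continuous input signal \<open>t \<mapsto> U\<^sub>t\<close> and
  in closed loop, \<open>U\<^sub>t = \<pi> (X\<^sub>t)\<close>, under every policy (the former does not entail the latter).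
\<close>

definition well_posed ::
    "(real ^ 'l \<Rightarrow> real ^ 'm \<Rightarrow> real ^ 'l) \<Rightarrow> (real ^ 'm) set \<Rightarrow> bool" where
  "well_posed f U \<longleftrightarrow>
     (\<forall>x u. continuous_on {0..} u \<longrightarrow> u ` {0..} \<subseteq> U \<longrightarrow> uniquely_defined (is_trajectory f u x)) \<and>
     (\<forall>x \<pi>. policy U \<pi> \<longrightarrow> uniquely_defined (\<lambda>X. is_trajectory f (\<pi> \<circ> X) x X))"

text \<open>
  The trajectory from \<open>x\<close> in closed loop with \<open>\<pi>\<close>.  Under \<^const>\<open>well_posed\<close> the choice
  is only relevant at negative times, which are never used.
\<close>

definition traj ::
    "(real ^ 'l \<Rightarrow> real ^ 'm \<Rightarrow> real ^ 'l) \<Rightarrow> (real ^ 'l \<Rightarrow> real ^ 'm) \<Rightarrow> real ^ 'l \<Rightarrow> real \<Rightarrow> real ^ 'l"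
  where
  "traj f \<pi> x = (SOME X. is_trajectory f (\<pi> \<circ> X) x X)"

definition discounted_return ::
    "(real ^ 'l \<Rightarrow> real ^ 'm \<Rightarrow> real ^ 'l) \<Rightarrow> (real ^ 'l \<Rightarrow> real ^ 'm \<Rightarrow> real) \<Rightarrow> real \<Rightarrow>
     (real ^ 'l \<Rightarrow> real ^ 'm) \<Rightarrow> real ^ 'l \<Rightarrow> real \<Rightarrow> real" where
  "discounted_return f r \<gamma> \<pi> x T =
     integral {0..T} (\<lambda>t. \<gamma> powr t * r (traj f \<pi> x t) (\<pi> (traj f \<pi> x t)))"

text \<open>
  The value function, an improper integral with values in \<open>[-\<infinity>, \<infinity>)\<close>.  The limit exists when
  \<open>r\<close> is bounded above (by \<open>0\<close> if \<open>\<gamma> = 1\<close>).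
\<close>

definition value_ext ::
    "(real ^ 'l \<Rightarrow> real ^ 'm \<Rightarrow> real ^ 'l) \<Rightarrow> (real ^ 'l \<Rightarrow> real ^ 'm \<Rightarrow> real) \<Rightarrow> real \<Rightarrow>
     (real ^ 'l \<Rightarrow> real ^ 'm) \<Rightarrow> real ^ 'l \<Rightarrow> ereal" where
  "value_ext f r \<gamma> \<pi> x = Lim at_top (\<lambda>T. ereal (discounted_return f r \<gamma> \<pi> x T))"

definition admissible_policy ::
    "(real ^ 'l \<Rightarrow> real ^ 'm \<Rightarrow> real ^ 'l) \<Rightarrow> (real ^ 'l \<Rightarrow> real ^ 'm \<Rightarrow> real) \<Rightarrow> real \<Rightarrow> (real ^ 'm) set \<Rightarrow>
     (real ^ 'l \<Rightarrow> real ^ 'm) \<Rightarrow> bool" where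
  "admissible_policy f r \<gamma> U \<pi> \<longleftrightarrow> policy U \<pi> \<and> (\<forall>x. \<bar>value_ext f r \<gamma> \<pi> x\<bar> \<noteq> \<infinity>)"

text \<open>The value function as a real function; meaningful for admissible policies.\<close>

definition value_fn ::
    "(real ^ 'l \<Rightarrow> real ^ 'm \<Rightarrow> real ^ 'l) \<Rightarrow> (real ^ 'l \<Rightarrow> real ^ 'm \<Rightarrow> real) \<Rightarrow> real \<Rightarrow>
     (real ^ 'l \<Rightarrow> real ^ 'm) \<Rightarrow> real ^ 'l \<Rightarrow> real" where
  "value_fn f r \<gamma> \<pi> x = real_of_ereal (value_ext f r \<gamma> \<pi> x)"

definition hamiltonian ::
    "(real ^ 'l \<Rightarrow> real ^ 'm \<Rightarrow> real ^ 'l) \<Rightarrow> (real ^ 'l \<Rightarrow> real ^ 'm \<Rightarrow> real) \<Rightarrow>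
     real ^ 'l \<Rightarrow> real ^ 'm \<Rightarrow> real ^ 'l \<Rightarrow> real" where
  "hamiltonian f r x u p = r x u + p \<bullet> f x u"

definition maximal_policy ::
    "(real ^ 'l \<Rightarrow> real ^ 'm \<Rightarrow> real ^ 'l) \<Rightarrow> (real ^ 'l \<Rightarrow> real ^ 'm \<Rightarrow> real) \<Rightarrow> real \<Rightarrow> (real ^ 'm) set \<Rightarrow>
     (real ^ 'l \<Rightarrow> real ^ 'm) \<Rightarrow> (real ^ 'l \<Rightarrow> real ^ 'm) \<Rightarrow> bool" where
  "maximal_policy f r \<gamma> U \<pi> \<pi>' \<longleftrightarrow> policy U \<pi>' \<and>
     (\<forall>x. is_arg_max (\<lambda>u. hamiltonian f r x u (gradient (value_fn f r \<gamma> \<pi>) x)) (\<lambda>u. u \<in> U) (\<pi>' x))"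

text \<open>Policy evaluation in differential and in integral policy iteration; \<open>\<alpha> = - ln \<gamma>\<close>.\<close>

definition dpi_evaluation ::
    "(real ^ 'l \<Rightarrow> real ^ 'm \<Rightarrow> real ^ 'l) \<Rightarrow> (real ^ 'l \<Rightarrow> real ^ 'm \<Rightarrow> real) \<Rightarrow> real \<Rightarrow>
     (real ^ 'l \<Rightarrow> real ^ 'm) \<Rightarrow> (real ^ 'l \<Rightarrow> real) \<Rightarrow> bool" where
  "dpi_evaluation f r \<gamma> \<pi> w \<longleftrightarrow> C1_on UNIV w \<and>
     (\<forall>x. - ln \<gamma> * w x = hamiltonian f r x (\<pi> x) (gradient w x))"

definition ipi_evaluation ::
    "(real ^ 'l \<Rightarrow> real ^ 'm \<Rightarrow> real ^ 'l) \<Rightarrow> (real ^ 'l \<Rightarrow> real ^ 'm \<Rightarrow> real) \<Rightarrow> real \<Rightarrow> real \<Rightarrow>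
     (real ^ 'l \<Rightarrow> real ^ 'm) \<Rightarrow> (real ^ 'l \<Rightarrow> real) \<Rightarrow> bool" where
  "ipi_evaluation f r \<gamma> \<eta> \<pi> w \<longleftrightarrow> C1_on UNIV w \<and>
     (\<forall>x. w x = discounted_return f r \<gamma> \<pi> x \<eta> + \<gamma> powr \<eta> * w (traj f \<pi> x \<eta>))"

end

theory Submission
  imports Defs
begin

text \<open>
  Differentiating \<open>t \<mapsto> \<integral>\<^sub>0\<^sup>t \<gamma>\<^sup>s R\<^sub>s ds + \<gamma>\<^sup>t w(X\<^sub>t)\<close> along a trajectory of \<open>\<pi>\<close> gives
  \<open>\<gamma>\<^sup>t (h(X\<^sub>t, \<pi>(X\<^sub>t), \<nabla>w(X\<^sub>t)) - \<alpha> w(X\<^sub>t))\<close>.  For constant \<open>w = r_max / \<alpha>\<close> this is nonpositive, so that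
  returns converge; for \<open>w\<close> solving the evaluation equation it vanishes, so that the boundary
  condition identifies \<open>w\<close> with the value function; for \<open>w = v\<^sub>\<pi>\<close> along a greedy policy it is
  nonnegative, so that the greedy policy is again admissible, with a larger value function (only the
  upper bound \<open>r_max / \<alpha>\<close> of \<open>v\<^sub>\<pi>\<close> is needed at infinity).  Policy iteration thus
  produces a bounded increasing sequence of value functions, whose limit is
  \<open>C\<^sup>1\<close> once the gradients converge locally uniformly, and the Bellman equations pass to the limit.

  Strict convexity of \<open>c\<close> makes \<open>\<sigma>(y)\<close> the unique maximiser of \<open>y \<bullet> a - c(a)\<close> over \<open>a \<in> A\<close>,
  and \<open>\<nabla>c\<close> and \<open>\<phi>\<close> have continuous inverses by invariance of domain.
\<close>

section \<open>Continuously differentiable functions\<close>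

text \<open>\<open>C1_on\<close> differentiates along a coordinate line only at parameter 0.
  Shifting the parameter reaches every point of that line, as the mean value theorem
  requires.\<close>

lemma C1_on_partial_DERIV:
  fixes g :: "real ^ 'n \<Rightarrow> real"
  assumes "C1_on S g" and "y + s *\<^sub>R axis i 1 \<in> interior S"
  shows "((\<lambda>s. g (y + s *\<^sub>R axis i 1)) has_real_derivative partial_deriv i g (y + s *\<^sub>R axis i 1)) (at s)"
proof -
  have "((\<lambda>u. g (y + s *\<^sub>R axis i 1 + u *\<^sub>R axis i 1))
      has_real_derivative partial_deriv i g (y + s *\<^sub>R axis i 1)) (at 0)"
    using assms by (simp add: C1_on_def partial_deriv_def DERIV_deriv_iff_field_differentiable)
  then have "((\<lambda>u. g (y + (u + s) *\<^sub>R axis i 1))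
      has_real_derivative partial_deriv i g (y + s *\<^sub>R axis i 1)) (at 0)"
    by (simp add: algebra_simps)
  then show ?thesis
    using DERIV_shift[of "\<lambda>u. g (y + u *\<^sub>R axis i 1)" _ 0 s] by simp
qed

text \<open>Enlarging \<open>I\<close> one index at a time traces a staircase from 0 to
  \<open>h\<close> with axis-parallel edges.\<close>

definition restrict_coords :: "'n set \<Rightarrow> real ^ 'n \<Rightarrow> real ^ 'n" where
  "restrict_coords I h = (\<chi> i. if i \<in> I then h $ i else 0)"

text \<open>Induction along the staircase. The edge in direction \<open>j\<close> contributes a
  partial derivative at an intermediate point, which continuity replaces by its value at
  \<open>x\<close>. The old edges and the new one each cost \<open>e/2\<close>, so the induction
  must keep \<open>e\<close> arbitrary.\<close>

lemma C1_on_coordinatewise_expansion: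
  fixes g :: "real ^ 'n \<Rightarrow> real"
  assumes C1: "C1_on S g" and x: "x \<in> interior S" and "finite I" and "0 < e"
  shows "\<exists>d>0. \<forall>h. norm h < d \<longrightarrow>
    \<bar>g (x + restrict_coords I h) - g x - (\<Sum>i\<in>I. partial_deriv i g x * h $ i)\<bar> \<le> e * norm h"
  using \<open>finite I\<close> \<open>0 < e\<close>
proof (induction I arbitrary: e rule: finite_induct)
  case empty
  have "restrict_coords {} h = 0" for h :: "real ^ 'n"
    by (simp add: restrict_coords_def vec_eq_iff)
  with empty show ?case
    by (auto intro!: exI[of _ 1])
next
  case (insert j I)
  from insert.IH[of "e/2"] insert.prems obtain d1 where d1: "d1 > 0"
    "\<And>h. norm h < d1 \<Longrightarrow>
      \<bar>g (x + restrict_coords I h) - g x - (\<Sum>i\<in>I. partial_deriv i g x * h $ i)\<bar> \<le> e/2 * norm h"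
    by auto
  obtain d2 where d2: "d2 > 0" "ball x d2 \<subseteq> interior S"
    using x open_contains_ball[of "interior S"] by auto
  have "continuous_on (interior S) (partial_deriv j g)"
    using C1 by (simp add: C1_on_def)
  then obtain d3 where d3: "d3 > 0"
    "\<And>y. y \<in> interior S \<Longrightarrow> dist y x < d3 \<Longrightarrow> dist (partial_deriv j g y) (partial_deriv j g x) < e/2"
    using x half_gt_zero[OF insert.prems] unfolding continuous_on_iff by blast
  define d where "d = min d1 (min d2 d3)"
  have "\<bar>g (x + restrict_coords (insert j I) h) - g x - (\<Sum>i\<in>insert j I. partial_deriv i g x * h $ i)\<bar>
      \<le> e * norm h" if h: "norm h < d" for h
  proof -
    define y where "y = x + restrict_coords I h"
    \<comment> \<open>The whole edge stays in the ball of radius \<open>d\<close> around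
      \<open>x\<close>, since its increments are dominated by \<open>h\<close> coordinate by
      coordinate.\<close>
    have near: "norm (restrict_coords I h + (s * h $ j) *\<^sub>R axis j 1) < d" if "0 \<le> s" "s \<le> 1" for s
    proof -
      have "norm (restrict_coords I h + (s * h $ j) *\<^sub>R axis j 1) \<le> norm h"
        using insert.hyps that
        by (intro norm_le_componentwise_cart)
           (auto simp: restrict_coords_def axis_def abs_mult mult_left_le_one_le)
      with h show ?thesis by simp
    qed
    have int: "y + (s * h $ j) *\<^sub>R axis j 1 \<in> interior S"
      and close: "dist (y + (s * h $ j) *\<^sub>R axis j 1) x < d3" if "0 \<le> s" "s \<le> 1" for s
      using near[OF that] d2 by (auto simp: y_def d_def dist_norm algebra_simps subset_iff norm_minus_commute)
    define k where "k s = g (y + (s * h $ j) *\<^sub>R axis j 1)" for s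
    have k': "(k has_real_derivative partial_deriv j g (y + (s * h $ j) *\<^sub>R axis j 1) * h $ j) (at s)"
      if "0 \<le> s" "s \<le> 1" for s
    proof -
      have "((\<lambda>s. s * h $ j) has_real_derivative h $ j) (at s)"
        by (auto intro!: derivative_eq_intros)
      from DERIV_chain2[OF C1_on_partial_DERIV[OF C1 int[OF that]] this]
      show ?thesis unfolding k_def .
    qed
    obtain z where z: "0 < z" "z < 1"
      "k 1 - k 0 = (1 - 0) * (partial_deriv j g (y + (z * h $ j) *\<^sub>R axis j 1) * h $ j)"
      using MVT2[of 0 1 k "\<lambda>s. partial_deriv j g (y + (s * h $ j) *\<^sub>R axis j 1) * h $ j"] k' by auto
    have "\<bar>k 1 - k 0 - partial_deriv j g x * h $ j\<bar>
        = \<bar>partial_deriv j g (y + (z * h $ j) *\<^sub>R axis j 1) - partial_deriv j g x\<bar> * \<bar>h $ j\<bar>"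
      by (simp add: z(3) left_diff_distrib flip: abs_mult)
    also have "\<dots> \<le> e/2 * norm h"
      using d3(2)[OF int[of z] close[of z]] z(1,2) insert.prems
      by (intro mult_mono component_le_norm_cart) (auto simp: dist_real_def)
    finally have 1: "\<bar>k 1 - k 0 - partial_deriv j g x * h $ j\<bar> \<le> e/2 * norm h" .
    have 2: "\<bar>k 0 - g x - (\<Sum>i\<in>I. partial_deriv i g x * h $ i)\<bar> \<le> e/2 * norm h"
      using d1(2)[of h] h by (simp add: k_def y_def d_def)
    have "restrict_coords (insert j I) h = restrict_coords I h + (h $ j) *\<^sub>R axis j 1"
      using insert.hyps by (auto simp: restrict_coords_def vec_eq_iff axis_def)
    then have "k 1 = g (x + restrict_coords (insert j I) h)"
      by (simp add: k_def y_def add.assoc)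
    with 1 2 show ?thesis
      unfolding sum.insert[OF insert.hyps] by linarith
  qed
  moreover have "d > 0"
    using d1 d2 d3 by (simp add: d_def)
  ultimately show ?case by blast
qed

text \<open>The expansion over all coordinates upgrades continuous partial derivatives to total
  differentiability, on which the chain rule along trajectories rests.\<close>

lemma C1_on_has_derivative:
  fixes g :: "real ^ 'n \<Rightarrow> real"
  assumes "C1_on S g" and "x \<in> interior S"
  shows "(g has_derivative (\<lambda>h. gradient g x \<bullet> h)) (at x)"
  unfolding has_derivative_at_alt
proof (intro conjI allI impI)
  show "bounded_linear (\<lambda>h. gradient g x \<bullet> h)"
    by (rule bounded_linear_inner_right)
  fix e :: real
  assume "0 < e"
  then obtain d where d: "d > 0" "\<And>h. norm h < d \<Longrightarrow>
      \<bar>g (x + restrict_coords UNIV h) - g x - (\<Sum>i\<in>UNIV. partial_deriv i g x * h $ i)\<bar> \<le> e * norm h"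
    using C1_on_coordinatewise_expansion[OF assms, of UNIV e] by auto
  have "restrict_coords UNIV h = h" for h :: "real ^ 'n"
    by (simp add: restrict_coords_def)
  then have "norm (g y - g x - gradient g x \<bullet> (y - x)) \<le> e * norm (y - x)" if "norm (y - x) < d" for y
    using d(2)[OF that] by (simp add: gradient_def inner_vec_def)
  with d(1) show "\<exists>d>0. \<forall>y. norm (y - x) < d \<longrightarrow>
      norm (g y - g x - gradient g x \<bullet> (y - x)) \<le> e * norm (y - x)"
    by blast
qed

lemma C1_on_continuous_gradient:
  assumes "C1_on S g"
  shows "continuous_on (interior S) (gradient g)"
  using assms unfolding C1_on_def gradient_def
  by (intro continuous_on_vec_lambda) auto

lemma has_derivative_imp_partial_DERIV:
  assumes "(g has_derivative (\<lambda>h. p \<bullet> h)) (at x)"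
  shows "((\<lambda>s. g (x + s *\<^sub>R axis i 1)) has_real_derivative p $ i) (at 0)"
proof -
  have "((\<lambda>s. x + s *\<^sub>R axis i 1) has_derivative (\<lambda>s. s *\<^sub>R axis i 1)) (at 0)"
    by (auto intro!: derivative_eq_intros)
  moreover have "(g has_derivative (\<lambda>h. p \<bullet> h)) (at (x + 0 *\<^sub>R axis i 1))"
    using assms by simp
  ultimately have "((\<lambda>s. g (x + s *\<^sub>R axis i 1)) has_derivative (\<lambda>s. p \<bullet> (s *\<^sub>R axis i 1))) (at 0)"
    by (rule has_derivative_compose)
  then show ?thesis
    by (simp add: has_field_derivative_def inner_axis mult.commute[of _ "p $ i"])
qed

lemma has_derivative_imp_gradient_eq:
  assumes "(g has_derivative (\<lambda>h. p \<bullet> h)) (at x)"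
  shows "gradient g x = p"
  using has_derivative_imp_partial_DERIV[OF assms]
  by (simp add: gradient_def partial_deriv_def vec_eq_iff DERIV_imp_deriv)

lemma has_derivative_imp_C1_on:
  assumes der: "\<And>x. (g has_derivative (\<lambda>h. G x \<bullet> h)) (at x)" and cont: "continuous_on UNIV G"
  shows "C1_on UNIV g"
proof -
  have "partial_deriv i g = (\<lambda>x. G x $ i)" for i
    using has_derivative_imp_gradient_eq[OF der] by (auto simp: gradient_def vec_eq_iff)
  moreover have "continuous_on UNIV (\<lambda>x. G x $ i)" for i
    using cont by (rule continuous_on_component)
  moreover have "(\<lambda>s. g (x + s *\<^sub>R axis i 1)) field_differentiable (at 0)" for x i
    using has_derivative_imp_partial_DERIV[OF der] unfolding field_differentiable_def by blast
  ultimately show ?thesis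
    by (simp add: C1_on_def)
qed

section \<open>Strict convexity and one-sided monotonicity\<close>

text \<open>Difference quotients from the right are at most the chord slope, but their limit keeps
  only a weak inequality. Strictness is recovered by applying the weak form at the midpoint, where
  \<open>c\<close> lies strictly below the chord.\<close>

lemma strictly_convex_on_imp_above_tangent:
  fixes c :: "real ^ 'n \<Rightarrow> real"
  assumes conv: "strictly_convex_on A c" and der: "(c has_derivative (\<lambda>h. p \<bullet> h)) (at a)"
    and a: "a \<in> A" and b: "b \<in> A" and "a \<noteq> b"
  shows "c a + p \<bullet> (b - a) < c b"
proof -
  have weak: "c a + p \<bullet> (b - a) \<le> c b" if b: "b \<in> A" and "a \<noteq> b" for b
  proof -
    have "((\<lambda>s. c (a + s *\<^sub>R (b - a))) has_derivative (\<lambda>s. p \<bullet> (s *\<^sub>R (b - a)))) (at 0)"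
      by (rule has_derivative_compose[of "\<lambda>s. a + s *\<^sub>R (b - a)" "\<lambda>s. s *\<^sub>R (b - a)"])
         (use der in \<open>auto intro!: derivative_eq_intros\<close>)
    then have "((\<lambda>s. c (a + s *\<^sub>R (b - a))) has_real_derivative p \<bullet> (b - a)) (at 0)"
      by (simp add: has_field_derivative_def mult.commute[of _ "p \<bullet> (b - a)"])
    then have "((\<lambda>s. (c (a + s *\<^sub>R (b - a)) - c a) / s) \<longlongrightarrow> p \<bullet> (b - a)) (at_right 0)"
      by (simp add: DERIV_def filterlim_at_split)
    moreover have "\<forall>\<^sub>F s in at_right 0. (c (a + s *\<^sub>R (b - a)) - c a) / s \<le> c b - c a"
      unfolding eventually_at_right_field
    proof (intro exI[of _ 1] conjI allI impI)
      fix s :: real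
      assume s: "0 < s" "s < 1"
      have "c ((1 - s) *\<^sub>R a + s *\<^sub>R b) < (1 - s) * c a + s * c b"
        using conv a b s \<open>a \<noteq> b\<close> unfolding strictly_convex_on_def by blast
      moreover have "(1 - s) *\<^sub>R a + s *\<^sub>R b = a + s *\<^sub>R (b - a)"
        by (simp add: algebra_simps)
      ultimately have "c (a + s *\<^sub>R (b - a)) - c a \<le> (c b - c a) * s"
        by (simp add: left_diff_distrib right_diff_distrib mult.commute)
      then show "(c (a + s *\<^sub>R (b - a)) - c a) / s \<le> c b - c a"
        using s by (simp add: pos_divide_le_eq)
    qed simp
    ultimately have "p \<bullet> (b - a) \<le> c b - c a"
      by (rule tendsto_upperbound) simp
    then show ?thesis by simp
  qed
  define m where "m = (1 - 1/2) *\<^sub>R a + (1/2) *\<^sub>R b"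
  have m: "m \<in> A"
    using conv a b unfolding strictly_convex_on_def m_def by (intro convexD_alt) auto
  have ma: "m - a = (1/2) *\<^sub>R (b - a)"
    by (simp add: m_def vec_eq_iff field_simps)
  with \<open>a \<noteq> b\<close> have "a \<noteq> m" by auto
  from weak[OF m this] have "c a + (p \<bullet> (b - a)) / 2 \<le> c m"
    by (simp add: ma)
  also have "c m < (1 - 1/2) * c a + 1/2 * c b"
    using conv a b \<open>a \<noteq> b\<close> unfolding strictly_convex_on_def m_def
    by (elim conjE ballE[of _ _ a] ballE[of _ _ b] allE[of _ "1/2"]) auto
  finally show ?thesis by simp
qed

text \<open>Derivatives along trajectories are one-sided at time 0, so the argument uses two-sided
  derivatives at interior times and continuity on the closed interval.\<close>

lemma DERIV_within_nonneg_imp_mono: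
  fixes F :: "real \<Rightarrow> real"
  assumes der: "\<And>t. 0 \<le> t \<Longrightarrow> (F has_real_derivative F' t) (at t within {0..})"
    and nonneg: "\<And>t. 0 \<le> t \<Longrightarrow> 0 \<le> F' t" and "0 \<le> a" "a \<le> b"
  shows "F a \<le> F b"
proof (rule DERIV_nonneg_imp_increasing_open[OF \<open>a \<le> b\<close>])
  fix t assume "a < t" "t < b"
  moreover from this \<open>0 \<le> a\<close> have "at t within {0..} = at t"
    by (intro at_within_interior) simp
  ultimately show "\<exists>y. (F has_real_derivative y) (at t) \<and> 0 \<le> y"
    using der[of t] nonneg[of t] \<open>0 \<le> a\<close> by auto
next
  have "continuous_on {0..} F"
    using der by (auto intro: DERIV_continuous_on)
  then show "continuous_on {a..b} F"
    by (rule continuous_on_subset) (use \<open>0 \<le> a\<close> in auto)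
qed

section \<open>Locally uniform convergence\<close>

text \<open>Transfers convergence from gradients to greedy policies. \<open>H\<close> is uniformly
  continuous only on compact sets, so the graphs of \<open>g\<close> and of almost all
  \<open>F n\<close> over a closed ball are first confined to one compact set
  \<open>K\<close>.\<close>

lemma locally_uniform_limit_compose:
  fixes F :: "nat \<Rightarrow> real ^ 'l \<Rightarrow> real ^ 'k" and H :: "real ^ 'l \<Rightarrow> real ^ 'k \<Rightarrow> real ^ 'm"
  assumes lim: "locally_uniform_limit F g" and g: "continuous_on UNIV g"
    and H: "continuous_on UNIV (\<lambda>(x, y). H x y)"
  shows "locally_uniform_limit (\<lambda>n x. H x (F n x)) (\<lambda>x. H x (g x))"
  unfolding locally_uniform_limit_def
proof
  fix x
  obtain N where N: "open N" "x \<in> N" "uniform_limit N F g sequentially"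
    using lim unfolding locally_uniform_limit_def by blast
  then obtain d where d: "d > 0" "cball x d \<subseteq> N"
    using open_contains_cball by blast
  have "bounded (g ` cball x d)"
    by (intro compact_imp_bounded compact_continuous_image continuous_on_subset[OF g]) auto
  then obtain B where B: "\<And>y. y \<in> cball x d \<Longrightarrow> norm (g y) \<le> B"
    unfolding bounded_iff by blast
  \<comment> \<open>The margin 1 beyond the bound \<open>B\<close> of \<open>g\<close> leaves room
    for every \<open>F n\<close> that is within \<open>min 1 e'\<close> of \<open>g\<close>.\<close>
  define K :: "((real ^ 'l) \<times> (real ^ 'k)) set" where "K = cball x d \<times> cball 0 (B + 1)"
  have "uniformly_continuous_on K (\<lambda>(x, y). H x y)"
    unfolding K_def
    by (intro compact_uniformly_continuous compact_Times continuous_on_subset[OF H]) auto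
  have "uniform_limit (ball x d) (\<lambda>n x. H x (F n x)) (\<lambda>x. H x (g x)) sequentially"
    unfolding uniform_limit_iff
  proof (intro allI impI)
    fix e :: real
    assume "e > 0"
    then obtain e' where e': "e' > 0"
      "\<And>p q. p \<in> K \<Longrightarrow> q \<in> K \<Longrightarrow> dist q p < e' \<Longrightarrow>
        dist ((\<lambda>(x, y). H x y) q) ((\<lambda>(x, y). H x y) p) < e"
      using uniformly_continuous_onE[OF \<open>uniformly_continuous_on K _\<close> \<open>e > 0\<close>] by blast
    have "\<forall>\<^sub>F n in sequentially. \<forall>y\<in>N. dist (F n y) (g y) < min 1 e'"
      using uniform_limitD[OF N(3), of "min 1 e'"] e'(1) by simp
    then show "\<forall>\<^sub>F n in sequentially. \<forall>y\<in>ball x d. dist (H y (F n y)) (H y (g y)) < e"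
    proof eventually_elim
      case (elim n)
      show ?case
      proof
        fix y
        assume y: "y \<in> ball x d"
        then have near: "dist (F n y) (g y) < 1" "dist (F n y) (g y) < e'"
          using elim d by (auto simp: subset_iff)
        have gy: "norm (g y) \<le> B"
          using B y by simp
        have "norm (F n y) \<le> norm (g y) + dist (F n y) (g y)"
          by (simp add: dist_norm norm_triangle_sub)
        with near gy y have "(y, g y) \<in> K" "(y, F n y) \<in> K"
          by (auto simp: K_def)
        then show "dist (H y (F n y)) (H y (g y)) < e"
          using e'(2)[of "(y, g y)" "(y, F n y)"] near by (simp add: dist_Pair_Pair)
      qed
    qed
  qed
  with d(1) show "\<exists>N. open N \<and> x \<in> N \<and> uniform_limit N (\<lambda>n x. H x (F n x)) (\<lambda>x. H x (g x)) sequentially"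
    by (intro exI[of _ "ball x d"]) auto
qed

text \<open>Allows the initial policy, which no improvement step produces, to be
  disregarded.\<close>

lemma locally_uniform_limit_cong:
  assumes "locally_uniform_limit F g" and "\<forall>\<^sub>F n in sequentially. F n = F' n"
  shows "locally_uniform_limit F' g"
  unfolding locally_uniform_limit_def
proof
  fix x
  obtain N where N: "open N" "x \<in> N" "uniform_limit N F g sequentially"
    using assms(1) unfolding locally_uniform_limit_def by blast
  have "\<forall>\<^sub>F n in sequentially. \<forall>y\<in>N. F n y = F' n y"
    using assms(2) by eventually_elim simp
  with N(3) have "uniform_limit N F' g sequentially"
    using uniform_limit_cong[of N F F' sequentially g g] by simp
  with N show "\<exists>N. open N \<and> x \<in> N \<and> uniform_limit N F' g sequentially"
    by blast
qed

lemma locally_uniform_limit_tendsto: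
  assumes "locally_uniform_limit F g"
  shows "(\<lambda>n. F n x) \<longlonglongrightarrow> g x"
proof -
  obtain N where "x \<in> N" "uniform_limit N F g sequentially"
    using assms unfolding locally_uniform_limit_def by blast
  then show ?thesis
    by (auto intro: tendsto_uniform_limitI)
qed

lemma locally_uniform_limit_continuous:
  fixes F :: "nat \<Rightarrow> 'a::t2_space \<Rightarrow> 'b::metric_space"
  assumes "locally_uniform_limit F g" and "\<forall>\<^sub>F n in sequentially. continuous_on UNIV (F n)"
  shows "continuous_on UNIV g"
proof -
  have "isCont g x" for x
  proof -
    obtain N where N: "open N" "x \<in> N" "uniform_limit N F g sequentially"
      using assms(1) unfolding locally_uniform_limit_def by blast
    have "continuous_on N g"
      by (rule uniform_limit_theorem[OF _ N(3)])
         (use assms(2) in \<open>auto elim!: eventually_mono intro: continuous_on_subset\<close>)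
    with N show ?thesis
      by (simp add: continuous_on_eq_continuous_at)
  qed
  then show ?thesis
    by (simp add: continuous_on_eq_continuous_within)
qed

text \<open>On a small ball, uniform convergence of derivatives permits termwise differentiation.
  The mean value inequality on the convex ball then controls \<open>w n - W\<close> by its value at
  the centre plus the radius times the gradient error.\<close>

lemma locally_uniform_gradient_limit:
  fixes w :: "nat \<Rightarrow> real ^ 'l \<Rightarrow> real"
  assumes C1: "\<forall>\<^sub>F n in sequentially. C1_on UNIV (w n)"
    and grad: "locally_uniform_limit (\<lambda>n. gradient (w n)) G"
    and lim: "\<And>x. (\<lambda>n. w n x) \<longlonglongrightarrow> W x"
  shows "(W has_derivative (\<lambda>h. G x \<bullet> h)) (at x)" and "locally_uniform_limit w W"
proof -
  have local: "(W has_derivative (\<lambda>h. G x \<bullet> h)) (at x) \<and>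
    (\<exists>N. open N \<and> x \<in> N \<and> uniform_limit N w W sequentially)" for x
  proof -
    obtain N where N: "open N" "x \<in> N" "uniform_limit N (\<lambda>n. gradient (w n)) G sequentially"
      using grad unfolding locally_uniform_limit_def by blast
    then obtain d where d: "d > 0" "ball x d \<subseteq> N"
      using open_contains_ball by blast
    \<comment> \<open>The theorem on differentiating sequences wants differentiability at every
      index, hence the shift by \<open>n0\<close>; the limit is unaffected.\<close>
    obtain n0 where n0: "\<And>n. n \<ge> n0 \<Longrightarrow> C1_on UNIV (w n)"
      using C1 by (auto simp: eventually_sequentially)
    have der: "(w n has_derivative (\<lambda>h. gradient (w n) y \<bullet> h)) (at y within S)" if "n \<ge> n0" for n y S
      using C1_on_has_derivative[OF n0[OF that]] by (auto intro: has_derivative_at_withinI)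
    have small: "\<forall>\<^sub>F n in sequentially. \<forall>y\<in>ball x d. norm (gradient (w n) y - G y) \<le> e" if "e > 0" for e
    proof -
      have "\<forall>\<^sub>F n in sequentially. \<forall>y\<in>N. dist (gradient (w n) y) (G y) < e"
        by (rule uniform_limitD[OF N(3) that])
      then show ?thesis
        by eventually_elim (use d(2) in \<open>auto simp: dist_norm subset_iff intro: less_imp_le\<close>)
    qed
    have "\<exists>g. \<forall>y\<in>ball x d. (\<lambda>n. w (n + n0) y) \<longlonglongrightarrow> g y \<and>
        (g has_derivative (\<lambda>h. G y \<bullet> h)) (at y within ball x d)"
    proof (rule has_derivative_sequence[where S = "ball x d" and f = "\<lambda>n. w (n + n0)"
            and f' = "\<lambda>n y h. gradient (w (n + n0)) y \<bullet> h"
            and g' = "\<lambda>y h. G y \<bullet> h" and l = "W x"])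
      show "(w (n + n0) has_derivative (\<lambda>h. gradient (w (n + n0)) y \<bullet> h)) (at y within ball x d)" for n y
        by (rule der) simp
      fix e :: real
      assume "e > 0"
      from sequentially_offset[OF small[OF this], of n0]
      show "\<forall>\<^sub>F n in sequentially. \<forall>y\<in>ball x d. \<forall>h.
          norm (gradient (w (n + n0)) y \<bullet> h - G y \<bullet> h) \<le> e * norm h"
      proof eventually_elim
        case (elim n)
        show ?case
          using elim by (auto simp flip: inner_diff_left
            intro!: order_trans[OF Cauchy_Schwarz_ineq2] mult_right_mono)
      qed
    qed (use d lim[of x] LIMSEQ_ignore_initial_segment in auto)
    then obtain g where "\<forall>y\<in>ball x d. (\<lambda>n. w (n + n0) y) \<longlonglongrightarrow> g y \<and>
        (g has_derivative (\<lambda>h. G y \<bullet> h)) (at y within ball x d)" ..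
    then have g: "(\<lambda>n. w (n + n0) y) \<longlonglongrightarrow> g y" "(g has_derivative (\<lambda>h. G y \<bullet> h)) (at y)"
      if "y \<in> ball x d" for y
      using that at_within_open[OF that open_ball] by metis+
    have gW: "g y = W y" if "y \<in> ball x d" for y
      using LIMSEQ_unique[OF g(1)[OF that] LIMSEQ_ignore_initial_segment[OF lim]] .
    have derW: "(W has_derivative (\<lambda>h. G y \<bullet> h)) (at y)" if "y \<in> ball x d" for y
      using has_derivative_transform_within_open[OF g(2)[OF that] open_ball that gW] .
    have "uniform_limit (ball x d) w W sequentially"
      unfolding uniform_limit_iff
    proof (intro allI impI)
      fix e :: real
      assume "e > 0"
      \<comment> \<open>A gradient error of \<open>e / (2 * d)\<close> over a distance of at most
        \<open>d\<close> costs \<open>e / 2\<close>; the error at the centre takes the other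
        half.\<close>
      then have e: "e / (2 * d) > 0" "e / 2 > 0"
        using d by auto
      have "\<forall>\<^sub>F n in sequentially. dist (w n x) (W x) < e / 2"
        using lim[of x] e(2) by (rule tendstoD)
      then show "\<forall>\<^sub>F n in sequentially. \<forall>y\<in>ball x d. dist (w n y) (W y) < e"
        using small[OF e(1)] eventually_ge_at_top[of n0]
      proof eventually_elim
        case (elim n)
        show ?case
        proof
          fix y assume y: "y \<in> ball x d"
          have "norm ((w n y - W y) - (w n x - W x)) \<le> e / (2 * d) * norm (y - x)"
          proof (rule differentiable_bound[OF convex_ball[of x d]])
            fix z assume z: "z \<in> ball x d"
            show "((\<lambda>z. w n z - W z) has_derivative (\<lambda>h. gradient (w n) z \<bullet> h - G z \<bullet> h))
                (at z within ball x d)"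
              using der[OF elim(3)] has_derivative_at_withinI[OF derW[OF z]] by (rule has_derivative_diff)
            show "onorm (\<lambda>h. gradient (w n) z \<bullet> h - G z \<bullet> h) \<le> e / (2 * d)"
            proof (rule onorm_le)
              fix h
              have "norm (gradient (w n) z - G z) \<le> e / (2 * d)"
                using elim(2) z by blast
              then show "norm (gradient (w n) z \<bullet> h - G z \<bullet> h) \<le> e / (2 * d) * norm h"
                unfolding inner_diff_left[symmetric] real_norm_def
                by (intro order_trans[OF Cauchy_Schwarz_ineq2] mult_right_mono) auto
            qed
          qed (use y d in auto)
          also have "\<dots> \<le> e / (2 * d) * d"
            using y e(1) by (intro mult_left_mono) (auto simp: dist_norm norm_minus_commute)
          also have "\<dots> = e / 2"
            using d by simp
          finally show "dist (w n y) (W y) < e"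
            using elim(1) unfolding dist_real_def real_norm_def by linarith
        qed
      qed
    qed
    with derW d show ?thesis
      by (auto intro!: exI[of _ "ball x d"])
  qed
  show "(W has_derivative (\<lambda>h. G x \<bullet> h)) (at x)" "locally_uniform_limit w W"
    using local by (auto simp: locally_uniform_limit_def)
qed

section \<open>Returns and value functions along trajectories\<close>

locale control_problem =
  fixes U :: "(real ^ 'm) set"
    and f :: "real ^ 'l \<Rightarrow> real ^ 'm \<Rightarrow> real ^ 'l"
    and r :: "real ^ 'l \<Rightarrow> real ^ 'm \<Rightarrow> real"
    and \<gamma> r_max :: real
  assumes continuous_f: "continuous_on (UNIV \<times> U) (\<lambda>(x, u). f x u)"
    and well_posed: "well_posed f U"
    and continuous_r: "continuous_on (UNIV \<times> U) (\<lambda>(x, u). r x u)"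
    and \<gamma>_pos: "0 < \<gamma>" and \<gamma>_le_1: "\<gamma> \<le> 1"
    and r_le_max: "u \<in> U \<Longrightarrow> r x u \<le> r_max"
    and r_max_eq_0: "\<gamma> = 1 \<Longrightarrow> r_max = 0"
begin

abbreviation return :: "(real ^ 'l \<Rightarrow> real ^ 'm) \<Rightarrow> real ^ 'l \<Rightarrow> real \<Rightarrow> real" where
  "return \<equiv> discounted_return f r \<gamma>"

lemma traj_is_trajectory:
  assumes "policy U \<pi>"
  shows "is_trajectory f (\<pi> \<circ> traj f \<pi> x) x (traj f \<pi> x)"
proof -
  have "\<exists>X. is_trajectory f (\<pi> \<circ> X) x X"
    using well_posed assms unfolding well_posed_def uniquely_defined_def by blast
  then show ?thesis
    unfolding traj_def by (rule someI_ex)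
qed

lemma traj_unique:
  assumes "policy U \<pi>" and "is_trajectory f (\<pi> \<circ> Y) x Y" and "0 \<le> t"
  shows "Y t = traj f \<pi> x t"
proof -
  have "uniquely_defined (\<lambda>X. is_trajectory f (\<pi> \<circ> X) x X)"
    using well_posed assms(1) by (simp add: well_posed_def)
  with assms(2,3) traj_is_trajectory[OF assms(1)] show ?thesis
    unfolding uniquely_defined_def by metis
qed

lemma traj_0 [simp]: "policy U \<pi> \<Longrightarrow> traj f \<pi> x 0 = x"
  using traj_is_trajectory by (simp add: is_trajectory_def)

lemma traj_has_vector_derivative:
  assumes "policy U \<pi>" and "0 \<le> t"
  shows "(traj f \<pi> x has_vector_derivative f (traj f \<pi> x t) (\<pi> (traj f \<pi> x t))) (at t within {0..})"
  using traj_is_trajectory[OF assms(1)] assms(2) by (simp add: is_trajectory_def)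

lemma continuous_on_traj:
  assumes "policy U \<pi>"
  shows "continuous_on {0..} (traj f \<pi> x)"
  using traj_has_vector_derivative[OF assms]
  by (auto intro!: continuous_on_vector_derivative)

text \<open>The closed loop is autonomous, so the shifted trajectory solves the same equation from
  its new initial state, and uniqueness applies.\<close>

lemma traj_add:
  assumes \<pi>: "policy U \<pi>" and s: "0 \<le> s" and t: "0 \<le> t"
  shows "traj f \<pi> x (s + t) = traj f \<pi> (traj f \<pi> x s) t"
proof (rule traj_unique[OF \<pi> _ t])
  have "((\<lambda>t. traj f \<pi> x (s + t)) has_vector_derivative
      f (traj f \<pi> x (s + t)) (\<pi> (traj f \<pi> x (s + t)))) (at t within {0..})" if "0 \<le> t" for t
  proof -
    have "((\<lambda>t. s + t) has_vector_derivative 1) (at t within {0..})"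
      by (auto intro!: derivative_eq_intros simp: has_vector_derivative_def)
    moreover have "(traj f \<pi> x has_vector_derivative
        f (traj f \<pi> x (s + t)) (\<pi> (traj f \<pi> x (s + t)))) (at (s + t) within (\<lambda>t. s + t) ` {0..})"
      by (rule has_vector_derivative_within_subset[OF traj_has_vector_derivative[OF \<pi>]])
         (use s that in auto)
    ultimately show ?thesis
      using vector_diff_chain_within[of "\<lambda>t. s + t" 1 t "{0..}" "traj f \<pi> x"] by (simp add: o_def)
  qed
  then show "is_trajectory f (\<pi> \<circ> (\<lambda>t. traj f \<pi> x (s + t))) (traj f \<pi> x s) (\<lambda>t. traj f \<pi> x (s + t))"
    by (simp add: is_trajectory_def)
qed

lemma continuous_on_reward:
  assumes "policy U \<pi>"
  shows "continuous_on {0..} (\<lambda>t. \<gamma> powr t * r (traj f \<pi> x t) (\<pi> (traj f \<pi> x t)))"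
proof -
  have "continuous_on {0..} (\<lambda>t. (traj f \<pi> x t, \<pi> (traj f \<pi> x t)))"
    using assms unfolding policy_def
    by (intro continuous_on_Pair continuous_on_traj assms
        continuous_on_compose2[OF _ continuous_on_traj[OF assms], of UNIV]) auto
  then have "continuous_on {0..} (\<lambda>t. (\<lambda>(x, u). r x u) (traj f \<pi> x t, \<pi> (traj f \<pi> x t)))"
    by (rule continuous_on_compose2[OF continuous_r]) (use assms in \<open>auto simp: policy_def\<close>)
  then show ?thesis
    using \<gamma>_pos by (auto intro!: continuous_intros)
qed

lemma DERIV_return:
  assumes "policy U \<pi>" and "0 \<le> t"
  shows "(return \<pi> x has_real_derivative \<gamma> powr t * r (traj f \<pi> x t) (\<pi> (traj f \<pi> x t)))
    (at t within {0..})"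
proof -
  have "((\<lambda>T. integral {0..T} (\<lambda>t. \<gamma> powr t * r (traj f \<pi> x t) (\<pi> (traj f \<pi> x t))))
      has_real_derivative \<gamma> powr t * r (traj f \<pi> x t) (\<pi> (traj f \<pi> x t))) (at t within {0..t + 1})"
    by (rule integral_has_real_derivative[OF continuous_on_subset[OF continuous_on_reward[OF assms(1)]]])
       (use assms in auto)
  \<comment> \<open>The fundamental theorem of calculus is applied on a compact interval; its
    artificial end \<open>t + 1\<close> is invisible near \<open>t\<close>.\<close>
  moreover have "at t within {0..t + 1} = at t within {0..}"
    by (rule at_within_nhd[of _ "{..<t + 1}"]) auto
  ultimately show ?thesis
    by (simp add: discounted_return_def[abs_def])
qed

lemma return_0 [simp]: "return \<pi> x 0 = 0"
  by (simp add: discounted_return_def)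

text \<open>The integral is cut at time \<open>s\<close>; its tail is the return of the restarted
  trajectory, with the discount accumulated up to \<open>s\<close> factored out.\<close>

lemma return_add:
  assumes \<pi>: "policy U \<pi>" and s: "0 \<le> s" and t: "0 \<le> t"
  shows "return \<pi> x (s + t) = return \<pi> x s + \<gamma> powr s * return \<pi> (traj f \<pi> x s) t"
proof -
  define R where "R x t = \<gamma> powr t * r (traj f \<pi> x t) (\<pi> (traj f \<pi> x t))" for x t
  have R: "continuous_on {a..b} (R x)" if "0 \<le> a" for a b x
    unfolding R_def by (rule continuous_on_subset[OF continuous_on_reward[OF \<pi>]]) (use that in auto)
  have "integral {0..s + t} (R x) = integral {0..s} (R x) + integral {s..s + t} (R x)"
    using s t by (intro Henstock_Kurzweil_Integration.integral_combine[symmetric]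
        integrable_continuous_interval R) auto
  also have "integral {s..s + t} (R x) = integral {0..t} (R x \<circ> (\<lambda>u. u + s))"
    using integral_shift[of 0 s t "R x"] R[of s "s + t" x] s by (simp add: add.commute)
  also have "\<dots> = integral {0..t} (\<lambda>u. \<gamma> powr s * R (traj f \<pi> x s) u)"
    using traj_add[OF \<pi> s, of _ x]
    by (intro integral_cong) (simp add: R_def powr_add add.commute)
  finally show ?thesis
    by (simp add: discounted_return_def R_def)
qed

text \<open>The derivative is the discounted residual of the evaluation equation for
  \<open>w\<close>. Hence the sign of the residual turns into monotonicity in time, and a vanishing
  residual into a conserved quantity.\<close>

lemma DERIV_return_plus:
  assumes \<pi>: "policy U \<pi>" and w: "C1_on UNIV w" and t: "0 \<le> t"
  shows "((\<lambda>t. return \<pi> x t + \<gamma> powr t * w (traj f \<pi> x t)) has_real_derivative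
    \<gamma> powr t * (hamiltonian f r (traj f \<pi> x t) (\<pi> (traj f \<pi> x t)) (gradient w (traj f \<pi> x t))
      - (- ln \<gamma>) * w (traj f \<pi> x t))) (at t within {0..})"
proof -
  let ?y = "traj f \<pi> x t"
  have "((\<lambda>t. w (traj f \<pi> x t)) has_derivative (\<lambda>h. gradient w ?y \<bullet> (h *\<^sub>R f ?y (\<pi> ?y))))
      (at t within {0..})"
    by (rule has_derivative_compose[OF traj_has_vector_derivative[OF \<pi> t, unfolded has_vector_derivative_def]
          C1_on_has_derivative[OF w]]) simp
  then have 1: "((\<lambda>t. w (traj f \<pi> x t)) has_real_derivative gradient w ?y \<bullet> f ?y (\<pi> ?y)) (at t within {0..})"
    by (simp add: has_field_derivative_def mult.commute[of _ "gradient w ?y \<bullet> f ?y (\<pi> ?y)"])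
  have 2: "((\<lambda>t. \<gamma> powr t) has_real_derivative ln \<gamma> * \<gamma> powr t) (at t within {0..})"
    using \<gamma>_pos by (auto simp: powr_def intro!: derivative_eq_intros)
  show ?thesis
    by (rule DERIV_cong[OF DERIV_add[OF DERIV_return[OF \<pi> t] DERIV_mult[OF 2 1]]])
       (simp add: hamiltonian_def algebra_simps)
qed

text \<open>The return of a policy earning the reward \<open>r_max\<close> forever; \<open>r_max = 0\<close> if \<open>\<gamma> = 1\<close>.\<close>

definition value_bound :: real where
  "value_bound = (if \<gamma> = 1 then 0 else r_max / (- ln \<gamma>))"

lemma discount_value_bound: "- ln \<gamma> * value_bound = r_max"
  using r_max_eq_0 \<gamma>_pos by (auto simp: value_bound_def)

text \<open>For \<open>\<gamma> < 1\<close> the discount decays; for \<open>\<gamma> = 1\<close> it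
  does not, but then the bound itself is 0.\<close>

lemma discounted_value_bound_tendsto_0: "((\<lambda>T. \<gamma> powr T * value_bound) \<longlongrightarrow> 0) at_top"
proof (cases "\<gamma> = 1")
  case True
  then show ?thesis unfolding value_bound_def by simp
next
  case False
  with \<gamma>_pos \<gamma>_le_1 have "ln \<gamma> < 0" by simp
  then have "filterlim (\<lambda>T. ln \<gamma> * T) at_bot at_top"
    by (intro filterlim_tendsto_neg_mult_at_bot[OF tendsto_const] filterlim_ident)
  then have "((\<lambda>T. exp (ln \<gamma> * T)) \<longlongrightarrow> 0) at_top"
    by (rule filterlim_compose[OF exp_at_bot])
  then have "((\<lambda>T. \<gamma> powr T) \<longlongrightarrow> 0) at_top"
    using \<gamma>_pos by (simp add: powr_def mult.commute)
  then show ?thesis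
    by (rule tendsto_mult_left_zero)
qed

text \<open>Adding to the return up to \<open>T\<close> what the reward \<open>r_max\<close> would
  still earn afterwards gives \<open>\<psi>\<close>, which is nonincreasing and so converges in the
  extended reals to its infimum. The added term vanishes in the limit, and \<open>\<psi> 0\<close>
  is \<open>value_bound\<close>.\<close>

lemma return_tendsto_value_ext:
  assumes \<pi>: "policy U \<pi>"
  shows "((\<lambda>T. ereal (return \<pi> x T)) \<longlongrightarrow> value_ext f r \<gamma> \<pi> x) at_top"
    and "value_ext f r \<gamma> \<pi> x \<le> ereal value_bound"
proof -
  define \<psi> where "\<psi> T = return \<pi> x T + \<gamma> powr T * value_bound" for T
  define L where "L = (INF T\<in>{0..}. ereal (\<psi> T))"
  have const: "((\<lambda>_. value_bound) has_derivative (\<lambda>h. 0 \<bullet> h)) (at y)" for y :: "real ^ 'l"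
    by simp
  have C1: "C1_on UNIV (\<lambda>_::real ^ 'l. value_bound)"
    by (rule has_derivative_imp_C1_on[OF const]) simp
  have grad: "gradient (\<lambda>_. value_bound) y = 0" for y :: "real ^ 'l"
    by (rule has_derivative_imp_gradient_eq[OF const])
  have anti: "\<psi> b \<le> \<psi> a" if "0 \<le> a" "a \<le> b" for a b
  proof -
    have "- \<psi> a \<le> - \<psi> b"
      using that
    proof (rule DERIV_within_nonneg_imp_mono[rotated 2])
      fix t :: real
      assume t: "0 \<le> t"
      show "((\<lambda>T. - \<psi> T) has_real_derivative
          - (\<gamma> powr t * (r (traj f \<pi> x t) (\<pi> (traj f \<pi> x t)) - r_max))) (at t within {0..})"
        using DERIV_minus[OF DERIV_return_plus[OF \<pi> C1 t, of x]]
        unfolding \<psi>_def grad discount_value_bound by (simp add: hamiltonian_def)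
      have "\<pi> (traj f \<pi> x t) \<in> U"
        using \<pi> by (auto simp: policy_def)
      then show "0 \<le> - (\<gamma> powr t * (r (traj f \<pi> x t) (\<pi> (traj f \<pi> x t)) - r_max))"
        using r_le_max \<gamma>_pos by (simp add: mult_nonneg_nonpos)
    qed
    then show ?thesis by simp
  qed
  have "((\<lambda>T. ereal (\<psi> T)) \<longlongrightarrow> L) at_top"
  proof (rule decreasing_tendsto)
    show "\<forall>\<^sub>F T in at_top. L \<le> ereal (\<psi> T)"
      using eventually_ge_at_top[of "0::real"]
      by eventually_elim (auto simp: L_def intro: INF_lower)
    fix z
    assume "L < z"
    then obtain T0 where "0 \<le> T0" "ereal (\<psi> T0) < z"
      by (auto simp: L_def INF_less_iff)
    have "ereal (\<psi> T) < z" if "T0 \<le> T" for T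
      using anti[OF \<open>0 \<le> T0\<close> that] \<open>ereal (\<psi> T0) < z\<close> by (meson ereal_less_eq(3) order.strict_trans1)
    then show "\<forall>\<^sub>F T in at_top. ereal (\<psi> T) < z"
      by (rule eventually_at_top_linorderI)
  qed
  moreover have "((\<lambda>T. ereal (- (\<gamma> powr T * value_bound))) \<longlongrightarrow> 0) at_top"
    using tendsto_minus[OF discounted_value_bound_tendsto_0] by (simp add: zero_ereal_def)
  \<comment> \<open>\<open>L\<close> may be \<open>-\<infinity>\<close>, but the other limit is
    finite, so addition is continuous here.\<close>
  ultimately have "((\<lambda>T. ereal (\<psi> T) + ereal (- (\<gamma> powr T * value_bound))) \<longlongrightarrow> L + 0) at_top"
    by (intro tendsto_add_ereal_general1) auto
  then have lim: "((\<lambda>T. ereal (return \<pi> x T)) \<longlongrightarrow> L) at_top"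
    by (simp add: \<psi>_def)
  then have "value_ext f r \<gamma> \<pi> x = L"
    unfolding value_ext_def by (intro tendsto_Lim) auto
  moreover have "L \<le> ereal (\<psi> 0)"
    unfolding L_def by (rule INF_lower) simp
  ultimately show "((\<lambda>T. ereal (return \<pi> x T)) \<longlongrightarrow> value_ext f r \<gamma> \<pi> x) at_top"
    "value_ext f r \<gamma> \<pi> x \<le> ereal value_bound"
    using lim \<gamma>_pos by (auto simp: \<psi>_def)
qed

lemma return_tendsto_value_fn:
  assumes "admissible_policy f r \<gamma> U \<pi>"
  shows "(return \<pi> x \<longlongrightarrow> value_fn f r \<gamma> \<pi> x) at_top"
    and "value_fn f r \<gamma> \<pi> x \<le> value_bound"
proof -
  have \<pi>: "policy U \<pi>" and eq: "value_ext f r \<gamma> \<pi> x = ereal (value_fn f r \<gamma> \<pi> x)"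
    using assms by (auto simp: admissible_policy_def value_fn_def ereal_real)
  show "(return \<pi> x \<longlongrightarrow> value_fn f r \<gamma> \<pi> x) at_top" "value_fn f r \<gamma> \<pi> x \<le> value_bound"
    using return_tendsto_value_ext[OF \<pi>, of x] unfolding eq by simp_all
qed

section \<open>Bellman equation, policy improvement and policy evaluation\<close>

text \<open>Both sides are limits of the return up to time \<open>t + T\<close> as \<open>T\<close>
  grows, once taken directly and once after splitting at \<open>t\<close>.\<close>

lemma value_fn_dynamic_programming:
  assumes adm: "admissible_policy f r \<gamma> U \<pi>" and t: "0 \<le> t"
  shows "return \<pi> x t + \<gamma> powr t * value_fn f r \<gamma> \<pi> (traj f \<pi> x t) = value_fn f r \<gamma> \<pi> x"
proof (rule tendsto_unique)
  have \<pi>: "policy U \<pi>"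
    using adm by (simp add: admissible_policy_def)
  show "((\<lambda>T. return \<pi> x (t + T)) \<longlongrightarrow> value_fn f r \<gamma> \<pi> x) at_top"
    using filterlim_compose[OF return_tendsto_value_fn(1)[OF adm]
        filterlim_tendsto_add_at_top[OF tendsto_const filterlim_ident]] by simp
  have "((\<lambda>T. return \<pi> x t + \<gamma> powr t * return \<pi> (traj f \<pi> x t) T) \<longlongrightarrow>
      return \<pi> x t + \<gamma> powr t * value_fn f r \<gamma> \<pi> (traj f \<pi> x t)) at_top"
    by (intro tendsto_intros return_tendsto_value_fn(1)[OF adm])
  then show "((\<lambda>T. return \<pi> x (t + T)) \<longlongrightarrow>
      return \<pi> x t + \<gamma> powr t * value_fn f r \<gamma> \<pi> (traj f \<pi> x t)) at_top"
    by (rule Lim_transform_eventually)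
       (use eventually_ge_at_top[of "0::real"] in eventually_elim, simp add: return_add[OF \<pi> t])
qed simp

text \<open>By dynamic programming the return plus discounted value is constant in \<open>t\<close>,
  so its one-sided derivative at 0, which is the residual at \<open>x\<close>, vanishes.\<close>

lemma value_fn_Bellman:
  assumes adm: "admissible_policy f r \<gamma> U \<pi>" and C1: "C1_on UNIV (value_fn f r \<gamma> \<pi>)"
  shows "- ln \<gamma> * value_fn f r \<gamma> \<pi> x = hamiltonian f r x (\<pi> x) (gradient (value_fn f r \<gamma> \<pi>) x)"
proof -
  have \<pi>: "policy U \<pi>"
    using adm by (simp add: admissible_policy_def)
  define H where "H = hamiltonian f r x (\<pi> x) (gradient (value_fn f r \<gamma> \<pi>) x)
    - (- ln \<gamma>) * value_fn f r \<gamma> \<pi> x"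
  have "((\<lambda>t. return \<pi> x t + \<gamma> powr t * value_fn f r \<gamma> \<pi> (traj f \<pi> x t)) has_real_derivative H)
      (at 0 within {0..})"
    using DERIV_return_plus[OF \<pi> C1, of 0 x] \<pi> \<gamma>_pos by (simp add: H_def)
  then have "((\<lambda>_. value_fn f r \<gamma> \<pi> x) has_vector_derivative H) (at (0::real) within {0..})"
    unfolding has_real_derivative_iff_has_vector_derivative
    by (rule has_vector_derivative_transform[rotated 2])
       (use value_fn_dynamic_programming[OF adm] in auto)
  moreover have "at (0::real) within {0..} \<noteq> bot"
    using trivial_limit_at_right_real[of "0::real"] at_within_Ici_at_right[of "0::real"]
    by (simp add: trivial_limit_def)
  ultimately have "H = 0"
    by (intro vector_derivative_unique_within[OF _ _ has_vector_derivative_const]) auto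
  then show ?thesis
    by (simp add: H_def)
qed

text \<open>The subsolution property makes the return plus discounted \<open>w\<close>
  nondecreasing. The upper bound replaces \<open>w\<close> at time \<open>T\<close> by a constant
  whose discounted value tends to 0, so \<open>w x\<close> bounds the value from below, which also
  rules out \<open>-\<infinity>\<close>.\<close>

lemma policy_improvement:
  assumes \<pi>: "policy U \<pi>" and C1: "C1_on UNIV w" and bound: "\<And>x. w x \<le> value_bound"
    and sub: "\<And>x. - ln \<gamma> * w x \<le> hamiltonian f r x (\<pi> x) (gradient w x)"
  shows "admissible_policy f r \<gamma> U \<pi>" and "w x \<le> value_fn f r \<gamma> \<pi> x"
proof -
  have "0 \<le> \<gamma> powr t * (hamiltonian f r y (\<pi> y) (gradient w y) - - ln \<gamma> * w y)" for t y
    using sub[of y] by (intro mult_nonneg_nonneg) simp_all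
  note mono = DERIV_within_nonneg_imp_mono[OF DERIV_return_plus[OF \<pi> C1] this]
  have le: "w x \<le> return \<pi> x T + \<gamma> powr T * value_bound" if "0 \<le> T" for x T
  proof -
    have "return \<pi> x 0 + \<gamma> powr 0 * w (traj f \<pi> x 0) \<le> return \<pi> x T + \<gamma> powr T * w (traj f \<pi> x T)"
      using mono[of 0 T] that by simp
    also have "\<dots> \<le> return \<pi> x T + \<gamma> powr T * value_bound"
      using bound by (intro add_mono mult_left_mono) auto
    finally show ?thesis
      using \<pi> \<gamma>_pos by simp
  qed
  \<comment> \<open>The limit is taken in the extended reals because finiteness of the value is
    still to be shown.\<close>
  have ext: "ereal (w x) \<le> value_ext f r \<gamma> \<pi> x" for x
  proof (rule tendsto_lowerbound)
    have "((\<lambda>T. ereal (\<gamma> powr T * value_bound)) \<longlongrightarrow> 0) at_top"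
      using discounted_value_bound_tendsto_0 by (simp add: zero_ereal_def)
    then have "((\<lambda>T. ereal (return \<pi> x T) + ereal (\<gamma> powr T * value_bound))
        \<longlongrightarrow> value_ext f r \<gamma> \<pi> x + 0) at_top"
      by (intro tendsto_add_ereal_general1 return_tendsto_value_ext[OF \<pi>]) auto
    then show "((\<lambda>T. ereal (return \<pi> x T) + ereal (\<gamma> powr T * value_bound))
        \<longlongrightarrow> value_ext f r \<gamma> \<pi> x) at_top"
      by simp
    show "\<forall>\<^sub>F T in at_top. ereal (w x) \<le> ereal (return \<pi> x T) + ereal (\<gamma> powr T * value_bound)"
      using eventually_ge_at_top[of "0::real"] by eventually_elim (simp add: le)
  qed simp
  have fin: "\<bar>value_ext f r \<gamma> \<pi> x\<bar> \<noteq> \<infinity>" for x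
    using ext[of x] return_tendsto_value_ext(2)[OF \<pi>, of x]
    by (cases "value_ext f r \<gamma> \<pi> x") auto
  then show "admissible_policy f r \<gamma> U \<pi>"
    using \<pi> by (simp add: admissible_policy_def)
  show "w x \<le> value_fn f r \<gamma> \<pi> x"
    using ext[of x] fin[of x] by (cases "value_ext f r \<gamma> \<pi> x") (auto simp: value_fn_def)
qed

text \<open>The residual of \<open>w\<close> vanishes, so \<open>\<psi>\<close> keeps its initial
  value \<open>w x\<close>; the boundary condition identifies its limit as the value.\<close>

lemma dpi_evaluation_eq_value_fn:
  assumes adm: "admissible_policy f r \<gamma> U \<pi>" and eval: "dpi_evaluation f r \<gamma> \<pi> w"
    and boundary: "((\<lambda>t. \<gamma> powr t * w (traj f \<pi> x t)) \<longlongrightarrow> 0) at_top"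
  shows "w x = value_fn f r \<gamma> \<pi> x"
proof -
  have \<pi>: "policy U \<pi>"
    using adm by (simp add: admissible_policy_def)
  have C1: "C1_on UNIV w"
    using eval by (simp add: dpi_evaluation_def)
  define \<psi> where "\<psi> t = return \<pi> x t + \<gamma> powr t * w (traj f \<pi> x t)" for t
  have der: "(\<psi> has_real_derivative 0) (at t within {0..})" if "0 \<le> t" for t
  proof -
    have "hamiltonian f r y (\<pi> y) (gradient w y) - - ln \<gamma> * w y = 0" for y
      using eval by (simp add: dpi_evaluation_def)
    with DERIV_return_plus[OF \<pi> C1 that, of x] show ?thesis
      unfolding \<psi>_def by (simp del: mult_minus_left)
  qed
  have "\<psi> t = w x" if "0 \<le> t" for t
  proof (rule antisym)
    have "\<psi> 0 = w x"
      using \<pi> \<gamma>_pos by (simp add: \<psi>_def)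
    then show "w x \<le> \<psi> t" "\<psi> t \<le> w x"
      using DERIV_within_nonneg_imp_mono[of \<psi> "\<lambda>_. 0" 0 t] der that
        DERIV_within_nonneg_imp_mono[of "\<lambda>t. - \<psi> t" "\<lambda>_. 0" 0 t] DERIV_minus[OF der]
      by auto
  qed
  then have "(\<psi> \<longlongrightarrow> w x) at_top"
    by (intro tendsto_eventually eventually_mono[OF eventually_ge_at_top[of "0::real"]])
  moreover have "(\<psi> \<longlongrightarrow> value_fn f r \<gamma> \<pi> x + 0) at_top"
    unfolding \<psi>_def[abs_def]
    by (intro tendsto_add return_tendsto_value_fn(1)[OF adm] boundary)
  ultimately show ?thesis
    using tendsto_unique[of "at_top :: real filter"] by fastforce
qed

text \<open>Restarting the trajectory at each multiple of \<open>\<eta>\<close> shows that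
  \<open>\<psi>\<close> returns to \<open>w x\<close> there. Nothing is claimed in between, but the
  limit of \<open>\<psi>\<close> exists and can be read off along these times.\<close>

lemma ipi_evaluation_eq_value_fn:
  assumes adm: "admissible_policy f r \<gamma> U \<pi>" and "0 < \<eta>" and eval: "ipi_evaluation f r \<gamma> \<eta> \<pi> w"
    and boundary: "((\<lambda>t. \<gamma> powr t * w (traj f \<pi> x t)) \<longlongrightarrow> 0) at_top"
  shows "w x = value_fn f r \<gamma> \<pi> x"
proof -
  have \<pi>: "policy U \<pi>"
    using adm by (simp add: admissible_policy_def)
  define \<psi> where "\<psi> t = return \<pi> x t + \<gamma> powr t * w (traj f \<pi> x t)" for t
  have iterate: "\<psi> (real n * \<eta>) = w x" for n
  proof (induction n)
    case 0
    then show ?case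
      using \<pi> \<gamma>_pos by (simp add: \<psi>_def)
  next
    case (Suc n)
    define s where "s = real n * \<eta>"
    have s: "0 \<le> s" "real (Suc n) * \<eta> = s + \<eta>"
      using \<open>0 < \<eta>\<close> by (simp_all add: s_def algebra_simps)
    have "w (traj f \<pi> x s) = return \<pi> (traj f \<pi> x s) \<eta> + \<gamma> powr \<eta> * w (traj f \<pi> (traj f \<pi> x s) \<eta>)"
      using eval unfolding ipi_evaluation_def by blast
    moreover have "return \<pi> x (s + \<eta>) = return \<pi> x s + \<gamma> powr s * return \<pi> (traj f \<pi> x s) \<eta>"
      "traj f \<pi> x (s + \<eta>) = traj f \<pi> (traj f \<pi> x s) \<eta>"
      using \<open>0 < \<eta>\<close> by (intro return_add[OF \<pi> s(1)] traj_add[OF \<pi> s(1)] less_imp_le; assumption)+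
    ultimately have "\<psi> (s + \<eta>) = \<psi> s"
      unfolding \<psi>_def by (simp only: powr_add distrib_left mult.assoc add.assoc)
    with Suc.IH s(2) show ?case
      by (simp add: s_def)
  qed
  have "filterlim (\<lambda>n. real n * \<eta>) at_top sequentially"
    using \<open>0 < \<eta>\<close> by (intro filterlim_at_top_mult_tendsto_pos[OF tendsto_const] filterlim_real_sequentially)
  moreover have "(\<psi> \<longlongrightarrow> value_fn f r \<gamma> \<pi> x + 0) at_top"
    unfolding \<psi>_def[abs_def]
    by (intro tendsto_add return_tendsto_value_fn(1)[OF adm] boundary)
  ultimately have "(\<lambda>n. \<psi> (real n * \<eta>)) \<longlonglongrightarrow> value_fn f r \<gamma> \<pi> x + 0"
    by (rule filterlim_compose[rotated])
  then show ?thesis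
    unfolding iterate using LIMSEQ_const_iff by fastforce
qed

end

section \<open>Greedy actions and policy iteration\<close>

locale convex_action_cost =
  fixes U A :: "(real ^ 'm) set" and \<phi> :: "real ^ 'm \<Rightarrow> real ^ 'm" and c :: "real ^ 'm \<Rightarrow> real"
  assumes continuous_\<phi>: "continuous_on U \<phi>" and \<phi>_image: "\<phi> ` U \<subseteq> A"
    and bij_\<phi>: "bij_betw \<phi> (interior U) (interior A)"
    and convex_c: "strictly_convex_on A c" and C1_c: "C1_on A c"
    and surj_gradient: "gradient c ` interior A = UNIV"
begin

text \<open>This is \<open>\<sigma>\<close>; composing it with the inverse of \<open>\<phi>\<close>
  gives \<open>\<sigma>'\<close>, which is \<open>best_action\<close>.\<close>

definition cost_gradient_inv :: "real ^ 'm \<Rightarrow> real ^ 'm" where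
  "cost_gradient_inv = inv_into (interior A) (gradient c)"

definition best_action :: "real ^ 'm \<Rightarrow> real ^ 'm" where
  "best_action y = inv_into (interior U) \<phi> (cost_gradient_inv y)"

lemma cost_above_tangent:
  assumes "a \<in> interior A" and "b \<in> A" and "a \<noteq> b"
  shows "c a + gradient c a \<bullet> (b - a) < c b"
  using strictly_convex_on_imp_above_tangent[OF convex_c C1_on_has_derivative[OF C1_c assms(1)]]
    assms interior_subset by blast

text \<open>If two points shared a gradient, adding their strict tangent inequalities would give a
  contradiction.\<close>

lemma inj_on_cost_gradient: "inj_on (gradient c) (interior A)"
proof (rule inj_onI, rule ccontr)
  fix a b
  assume ab: "a \<in> interior A" "b \<in> interior A" "gradient c a = gradient c b" "a \<noteq> b"
  then have "c a + gradient c a \<bullet> (b - a) < c b" "c b + gradient c a \<bullet> (a - b) < c a"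
    using cost_above_tangent[of a b] cost_above_tangent[of b a] interior_subset[of A] by auto
  then show False
    by (simp add: inner_diff_right)
qed

lemma cost_gradient_inv_interior: "cost_gradient_inv y \<in> interior A"
  unfolding cost_gradient_inv_def using surj_gradient by (intro inv_into_into) simp

lemma gradient_cost_gradient_inv [simp]: "gradient c (cost_gradient_inv y) = y"
  unfolding cost_gradient_inv_def using surj_gradient by (intro f_inv_into_f) simp

text \<open>The gradient is only known to be continuous, so the inverse function theorem does not
  apply. Invariance of domain does: a continuous injection of an open set into a space of the same
  dimension has a continuous inverse.\<close>

lemma continuous_cost_gradient_inv: "continuous_on UNIV cost_gradient_inv"
proof -
  have "continuous_on (gradient c ` interior A) cost_gradient_inv"
    by (rule continuous_on_inverse_open[OF open_interior C1_on_continuous_gradient[OF C1_c]])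
       (simp_all add: cost_gradient_inv_def inj_on_cost_gradient)
  then show ?thesis
    by (simp add: surj_gradient)
qed

lemma best_action_interior: "best_action y \<in> interior U"
  unfolding best_action_def using bij_\<phi> cost_gradient_inv_interior[of y]
  by (intro inv_into_into) (simp add: bij_betw_def)

lemma \<phi>_best_action [simp]: "\<phi> (best_action y) = cost_gradient_inv y"
  unfolding best_action_def using bij_\<phi> cost_gradient_inv_interior[of y]
  by (intro f_inv_into_f) (simp add: bij_betw_def)

lemma best_action_in: "best_action y \<in> U"
  using best_action_interior interior_subset by blast

lemma continuous_best_action: "continuous_on UNIV best_action"
proof -
  have "continuous_on (\<phi> ` interior U) (inv_into (interior U) \<phi>)"
    using bij_\<phi> continuous_on_subset[OF continuous_\<phi> interior_subset]
    by (intro continuous_on_inverse_open[OF open_interior]) (simp_all add: bij_betw_def)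
  moreover have "\<phi> ` interior U = interior A"
    using bij_\<phi> by (simp add: bij_betw_def)
  ultimately show ?thesis
    unfolding best_action_def[abs_def]
    by (intro continuous_on_compose2[OF _ continuous_cost_gradient_inv])
       (auto simp: cost_gradient_inv_interior)
qed

text \<open>The tangent inequality at \<open>cost_gradient_inv y\<close>, where the gradient is
  \<open>y\<close>, rearranged. The competitor \<open>\<phi> u\<close> may lie on the boundary of
  \<open>A\<close>.\<close>

lemma best_action_maximizes:
  assumes "u \<in> U"
  shows "y \<bullet> \<phi> u - c (\<phi> u) \<le> y \<bullet> \<phi> (best_action y) - c (\<phi> (best_action y))"
proof (cases "\<phi> u = cost_gradient_inv y")
  case False
  have "\<phi> u \<in> A"
    using assms \<phi>_image by blast
  from cost_above_tangent[OF cost_gradient_inv_interior this False[symmetric]]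
  show ?thesis
    by (simp add: inner_diff_right)
qed simp

end

section \<open>Greedy policies for dynamics affine in the transformed input\<close>

locale input_affine_problem =
  control_problem U f r \<gamma> r_max + convex_action_cost U A \<phi> c
  for U A :: "(real ^ 'm) set"
    and f :: "real ^ 'l \<Rightarrow> real ^ 'm \<Rightarrow> real ^ 'l"
    and r :: "real ^ 'l \<Rightarrow> real ^ 'm \<Rightarrow> real"
    and \<gamma> r_max :: real and \<phi> :: "real ^ 'm \<Rightarrow> real ^ 'm" and c :: "real ^ 'm \<Rightarrow> real" +
  fixes f_d :: "real ^ 'l \<Rightarrow> real ^ 'l" and F_c :: "real ^ 'l \<Rightarrow> real ^ 'm ^ 'l"
    and r_0 :: "real ^ 'l \<Rightarrow> real"
  assumes dynamics: "u \<in> U \<Longrightarrow> f x u = f_d x + F_c x *v \<phi> u"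
    and reward: "u \<in> U \<Longrightarrow> r x u = r_0 x - c (\<phi> u)"
    and continuous_F_c: "continuous_on UNIV F_c"
    and C1_value_fn: "admissible_policy f r \<gamma> U \<pi> \<Longrightarrow> C1_on UNIV (value_fn f r \<gamma> \<pi>)"
begin

definition greedy_action :: "real ^ 'l \<Rightarrow> real ^ 'l \<Rightarrow> real ^ 'm" where
  "greedy_action x p = best_action (transpose (F_c x) *v p)"

lemma greedy_action_in: "greedy_action x p \<in> U"
  by (simp add: greedy_action_def best_action_in)

text \<open>Moving \<open>F_c x\<close> across the inner product leaves
  \<open>y \<bullet> \<phi> u - c (\<phi> u)\<close> as the only part depending on \<open>u\<close>,
  with \<open>y\<close> the transpose of \<open>F_c x\<close> applied to \<open>p\<close>.\<close>

lemma hamiltonian_le_greedy_action: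
  assumes "u \<in> U"
  shows "hamiltonian f r x u p \<le> hamiltonian f r x (greedy_action x p) p"
proof -
  have "hamiltonian f r x u p = r_0 x + p \<bullet> f_d x + ((transpose (F_c x) *v p) \<bullet> \<phi> u - c (\<phi> u))"
    if "u \<in> U" for u
    using that by (simp add: hamiltonian_def dynamics reward inner_add_right dot_lmul_matrix transpose_matrix_vector)
  then show ?thesis
    using best_action_maximizes[OF assms] assms by (simp add: greedy_action_def best_action_in del: \<phi>_best_action)
qed

text \<open>Joint continuity makes greedy feedback a policy and carries locally uniform convergence
  from gradients to policies.\<close>

lemma continuous_greedy_action: "continuous_on UNIV (\<lambda>(x, p). greedy_action x p)"
proof -
  have "continuous_on UNIV (\<lambda>z. F_c (fst z) :: real ^ 'm ^ 'l)"
    by (rule continuous_on_compose2[OF continuous_F_c]) (auto intro!: continuous_intros)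
  then have "continuous_on UNIV (\<lambda>z. transpose (F_c (fst z)) *v snd z)"
    unfolding matrix_vector_mult_def transpose_def
    by (auto intro!: continuous_on_vec_lambda continuous_intros)
  from continuous_on_compose2[OF continuous_best_action this]
  show ?thesis
    by (simp add: greedy_action_def case_prod_unfold)
qed

lemma policy_greedy_action:
  assumes "continuous_on UNIV G"
  shows "policy U (\<lambda>x. greedy_action x (G x))"
  unfolding policy_def
  using continuous_on_compose2[OF continuous_greedy_action continuous_on_Pair[OF continuous_on_id assms]]
    greedy_action_in by auto

lemma maximal_policy_greedy_action:
  assumes "admissible_policy f r \<gamma> U \<pi>"
  shows "maximal_policy f r \<gamma> U \<pi> (\<lambda>x. greedy_action x (gradient (value_fn f r \<gamma> \<pi>) x))"
  using policy_greedy_action C1_on_continuous_gradient[OF C1_value_fn[OF assms]]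
  by (simp add: maximal_policy_def is_arg_max_linorder greedy_action_in hamiltonian_le_greedy_action)

text \<open>The value of \<open>\<pi>\<close> satisfies the Bellman equation with equality; a greedy
  action can only raise the Hamiltonian, which turns that value into a subsolution for
  \<open>\<pi>'\<close>.\<close>

lemma greedy_policy_improves:
  assumes adm: "admissible_policy f r \<gamma> U \<pi>"
    and \<pi>': "\<pi>' = (\<lambda>x. greedy_action x (gradient (value_fn f r \<gamma> \<pi>) x))"
  shows "admissible_policy f r \<gamma> U \<pi>'" and "value_fn f r \<gamma> \<pi> x \<le> value_fn f r \<gamma> \<pi>' x"
proof -
  note C1 = C1_value_fn[OF adm]
  have "\<pi> y \<in> U" for y
    using adm by (auto simp: admissible_policy_def policy_def)
  then have "- ln \<gamma> * value_fn f r \<gamma> \<pi> y \<le> hamiltonian f r y (\<pi>' y) (gradient (value_fn f r \<gamma> \<pi>) y)" for y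
    unfolding value_fn_Bellman[OF adm C1] \<pi>' by (rule hamiltonian_le_greedy_action)
  moreover have "policy U \<pi>'"
    unfolding \<pi>' using C1_on_continuous_gradient[OF C1] by (intro policy_greedy_action) simp
  ultimately show "admissible_policy f r \<gamma> U \<pi>'" "value_fn f r \<gamma> \<pi> x \<le> value_fn f r \<gamma> \<pi>' x"
    using policy_improvement[OF _ C1 return_tendsto_value_fn(2)[OF adm]] by blast+
qed

text \<open>Each iterate is the value function of the preceding policy, so the iterates increase
  below \<open>value_bound\<close> and converge pointwise to their supremum. Gradient convergence
  then makes the limit C^1, and the Bellman equations pass to it.\<close>

lemma policy_iteration_converges:
  fixes v :: "nat \<Rightarrow> real ^ 'l \<Rightarrow> real" and \<pi> :: "nat \<Rightarrow> real ^ 'l \<Rightarrow> real ^ 'm"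
  defines "v_star \<equiv> \<lambda>x. SUP i\<in>{1..}. v i x"
  assumes adm0: "admissible_policy f r \<gamma> U (\<pi> 0)"
    and eval: "(\<forall>i\<ge>1. dpi_evaluation f r \<gamma> (\<pi> (i - 1)) (v i)) \<or>
      (\<exists>\<eta>>0. \<forall>i\<ge>1. ipi_evaluation f r \<gamma> \<eta> (\<pi> (i - 1)) (v i))"
    and improve: "\<And>i. 1 \<le> i \<Longrightarrow> \<pi> i = (\<lambda>x. greedy_action x (gradient (v i) x))"
    and boundary: "\<And>i x. 1 \<le> i \<Longrightarrow> admissible_policy f r \<gamma> U (\<pi> (i - 1)) \<Longrightarrow>
      ((\<lambda>t. \<gamma> powr t * v i (traj f (\<pi> (i - 1)) x t)) \<longlongrightarrow> 0) at_top"
    and grad: "locally_uniform_limit (\<lambda>i. gradient (v i)) g"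
  shows "bdd_above ((\<lambda>i. v i x) ` {1..})"
    and "attains_max (\<lambda>u. hamiltonian f r x u (gradient v_star x)) U (- ln \<gamma> * v_star x)"
    and "C1_on UNIV v_star"
    and "locally_uniform_limit v v_star"
    and "locally_uniform_limit (\<lambda>i. gradient (v i)) (gradient v_star)"
    and "locally_uniform_limit \<pi> (\<lambda>x. greedy_action x (gradient v_star x))"
proof -
  have evaluation: "v (Suc i) = value_fn f r \<gamma> (\<pi> i)" if adm: "admissible_policy f r \<gamma> U (\<pi> i)" for i
  proof
    fix x
    have "((\<lambda>t. \<gamma> powr t * v (Suc i) (traj f (\<pi> i) x t)) \<longlongrightarrow> 0) at_top"
      using boundary[of "Suc i" x] adm by simp
    moreover from eval consider "dpi_evaluation f r \<gamma> (\<pi> i) (v (Suc i))"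
      | \<eta> where "0 < \<eta>" "ipi_evaluation f r \<gamma> \<eta> (\<pi> i) (v (Suc i))"
      by (metis diff_Suc_1 le_add1 plus_1_eq_Suc)
    ultimately show "v (Suc i) x = value_fn f r \<gamma> (\<pi> i) x"
      using adm by cases (blast intro: dpi_evaluation_eq_value_fn ipi_evaluation_eq_value_fn)+
  qed
  \<comment> \<open>The boundary condition is available only for admissible policies. Hence each
    step of the induction first identifies \<open>v (Suc i)\<close> as a value function, and then
    improvement yields admissibility of the next policy.\<close>
  have adm: "admissible_policy f r \<gamma> U (\<pi> i)" for i
  proof (induction i)
    case (Suc i)
    then show ?case
      using greedy_policy_improves(1)[OF Suc improve[of "Suc i", unfolded evaluation[OF Suc]]] by simp
  qed (rule adm0)
  note evaluation = evaluation[OF adm]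
  \<comment> \<open>\<open>v 0\<close> is arbitrary, so every property of the iterates is stated for
    successors or eventually.\<close>
  have C1: "C1_on UNIV (v (Suc i))" for i
    unfolding evaluation by (rule C1_value_fn[OF adm])
  have bound: "v (Suc i) x \<le> value_bound" for i x
    unfolding evaluation by (rule return_tendsto_value_fn(2)[OF adm])
  have mono: "incseq (\<lambda>i. v (Suc i) x)" for x
  proof (rule incseq_SucI)
    fix i
    show "v (Suc i) x \<le> v (Suc (Suc i)) x"
      using greedy_policy_improves(2)[OF adm improve[of "Suc i", unfolded evaluation]] by (simp add: evaluation)
  qed
  have image: "(\<lambda>i. v i x) ` {1..} = range (\<lambda>i. v (Suc i) x)" for x
  proof -
    have "{1..} = range Suc"
      by (auto simp: image_iff Suc_le_eq gr0_conv_Suc)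
    then show ?thesis
      by (simp add: image_image)
  qed
  show bdd: "bdd_above ((\<lambda>i. v i x) ` {1..})" for x
    unfolding image using bound by (auto intro!: bdd_aboveI)
  have "(\<lambda>i. v (Suc i) x) \<longlonglongrightarrow> v_star x" for x
    unfolding v_star_def image using bdd[of x, unfolded image] mono by (rule LIMSEQ_incseq_SUP)
  then have lim: "(\<lambda>i. v i x) \<longlonglongrightarrow> v_star x" for x
    by (rule LIMSEQ_imp_Suc)
  have ev_C1: "\<forall>\<^sub>F i in sequentially. C1_on UNIV (v i)"
    using C1 eventually_sequentially_Suc[of "\<lambda>i. C1_on UNIV (v i)"] by simp
  then have cont_g: "continuous_on UNIV g"
    by (intro locally_uniform_limit_continuous[OF grad])
       (auto elim!: eventually_mono dest: C1_on_continuous_gradient)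
  have der: "(v_star has_derivative (\<lambda>h. g x \<bullet> h)) (at x)" for x
    using locally_uniform_gradient_limit(1)[OF ev_C1 grad lim] .
  have g: "gradient v_star = g"
    using has_derivative_imp_gradient_eq[OF der] by blast
  show "C1_on UNIV v_star"
    using der cont_g by (rule has_derivative_imp_C1_on)
  show "locally_uniform_limit v v_star"
    using locally_uniform_gradient_limit(2)[OF ev_C1 grad lim] .
  show "locally_uniform_limit (\<lambda>i. gradient (v i)) (gradient v_star)"
    unfolding g by (rule grad)
  have "\<forall>\<^sub>F i in sequentially. (\<lambda>x. greedy_action x (gradient (v i) x)) = \<pi> i"
    using eventually_ge_at_top[of 1] by eventually_elim (rule improve[symmetric])
  then show lim_\<pi>: "locally_uniform_limit \<pi> (\<lambda>x. greedy_action x (gradient v_star x))"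
    unfolding g
    by (rule locally_uniform_limit_cong[OF locally_uniform_limit_compose[OF grad cont_g continuous_greedy_action]])
  show "attains_max (\<lambda>u. hamiltonian f r x u (gradient v_star x)) U (- ln \<gamma> * v_star x)"
  proof -
    define u where "u = greedy_action x (g x)"
    have u: "u \<in> U"
      by (simp add: u_def greedy_action_in)
    have "\<pi> i x \<in> U" for i
      using adm[of i] by (auto simp: admissible_policy_def policy_def)
    moreover have "(\<lambda>i. \<pi> i x) \<longlonglongrightarrow> u"
      using locally_uniform_limit_tendsto[OF lim_\<pi>] by (simp add: u_def g)
    ultimately have pair: "(\<lambda>i. (x, \<pi> i x)) \<longlonglongrightarrow> (x, u)"
      and pair_in: "\<forall>\<^sub>F i in sequentially. (x, \<pi> i x) \<in> UNIV \<times> U"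
      by (auto intro: tendsto_Pair)
    have "(x, u) \<in> UNIV \<times> U"
      using u by simp
    \<comment> \<open>\<open>f\<close> and \<open>r\<close> are continuous only over actions in
      \<open>U\<close>, so both the policies and their limit must take values there.\<close>
    note at_u = continuous_on_tendsto_compose[OF _ pair this pair_in]
    have "(\<lambda>i. gradient (v (Suc i)) x) \<longlonglongrightarrow> g x"
      using locally_uniform_limit_tendsto[OF grad] by (rule LIMSEQ_Suc)
    then have "(\<lambda>i. hamiltonian f r x (\<pi> i x) (gradient (v (Suc i)) x)) \<longlonglongrightarrow> hamiltonian f r x u (g x)"
      using at_u[OF continuous_f] at_u[OF continuous_r]
      unfolding hamiltonian_def by (auto intro!: tendsto_intros)
    \<comment> \<open>\<open>\<pi> i\<close> is paired with the function that evaluates it, not with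
      \<open>v i\<close>, from which it was built. In the limit the two gradients agree, so
      \<open>u\<close> is greedy for the very gradient in the equation.\<close>
    moreover have "hamiltonian f r x (\<pi> i x) (gradient (v (Suc i)) x) = - ln \<gamma> * v (Suc i) x" for i
      using value_fn_Bellman[OF adm C1_value_fn[OF adm]] by (simp add: evaluation)
    ultimately have "(\<lambda>i. - ln \<gamma> * v (Suc i) x) \<longlonglongrightarrow> hamiltonian f r x u (g x)"
      by simp
    then have "- ln \<gamma> * v_star x = hamiltonian f r x u (g x)"
      by (rule LIMSEQ_unique[rotated]) (intro tendsto_intros LIMSEQ_Suc[OF lim])
    then show ?thesis
      using hamiltonian_le_greedy_action[of _ x "g x"] u
      unfolding attains_max_def g u_def by metis
  qed
qed

end

text \<open>The clause on \<open>bdd_above\<close> ensures that the real-valued \<open>SUP\<close>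
  defining \<open>v_star\<close> is a genuine supremum.\<close>

theorem theorem5p4:
  fixes U A :: "(real ^ 'm) set"
    and f :: "real ^ 'l \<Rightarrow> real ^ 'm \<Rightarrow> real ^ 'l"
    and r :: "real ^ 'l \<Rightarrow> real ^ 'm \<Rightarrow> real"
    and \<gamma> \<alpha> r_max :: real
    and f_d :: "real ^ 'l \<Rightarrow> real ^ 'l"
    and F_c :: "real ^ 'l \<Rightarrow> real ^ 'm ^ 'l"
    and r_0 :: "real ^ 'l \<Rightarrow> real"
    and \<phi> :: "real ^ 'm \<Rightarrow> real ^ 'm"
    and c :: "real ^ 'm \<Rightarrow> real"
    and \<sigma> \<sigma>' :: "real ^ 'm \<Rightarrow> real ^ 'm"
  assumes "action_space U"
    and "continuous_on (UNIV \<times> U) (\<lambda>(x, u). f x u)"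
    and "well_posed f U"
    and "continuous_on (UNIV \<times> U) (\<lambda>(x, u). r x u)"
    and "0 < \<gamma>" and "\<gamma> \<le> 1" and "\<alpha> = - ln \<gamma>"
    and "attains_max (\<lambda>(x, u). r x u) (UNIV \<times> U) r_max"
    and "\<gamma> = 1 \<Longrightarrow> r_max = 0"
    and "\<exists>\<pi>. admissible_policy f r \<gamma> U \<pi>"
    and "\<And>\<pi>. admissible_policy f r \<gamma> U \<pi> \<Longrightarrow> C1_on UNIV (value_fn f r \<gamma> \<pi>)"
    and "\<And>x u. u \<in> U \<Longrightarrow> f x u = f_d x + F_c x *v \<phi> u"
    and "\<And>x u. u \<in> U \<Longrightarrow> r x u = r_0 x - c (\<phi> u)"
    and "continuous_on UNIV f_d" and "continuous_on UNIV F_c" and "continuous_on UNIV r_0"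
    and "action_space A"
    and "continuous_on U \<phi>" and "\<phi> ` U \<subseteq> A"
    and "bij_betw \<phi> (interior U) (interior A)"
    and "strictly_convex_on A c" and "C1_on A c"
    and "gradient c ` interior A = UNIV"
    and "\<sigma> = inv_into (interior A) (gradient c)"
    and "\<sigma>' = (\<lambda>y. inv_into (interior U) \<phi> (\<sigma> y))"
  shows
    "(\<forall>\<pi>. admissible_policy f r \<gamma> U \<pi> \<longrightarrow>
        maximal_policy f r \<gamma> U \<pi>
          (\<lambda>x. \<sigma>' (transpose (F_c x) *v gradient (value_fn f r \<gamma> \<pi>) x)))
     \<and>
     (\<forall>(v :: nat \<Rightarrow> real ^ 'l \<Rightarrow> real) (\<pi> :: nat \<Rightarrow> real ^ 'l \<Rightarrow> real ^ 'm) v_star \<pi>_star.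
        admissible_policy f r \<gamma> U (\<pi> 0) \<longrightarrow>
        ((\<forall>i\<ge>1. dpi_evaluation f r \<gamma> (\<pi> (i - 1)) (v i)) \<or>
         (\<exists>\<eta>>0. \<forall>i\<ge>1. ipi_evaluation f r \<gamma> \<eta> (\<pi> (i - 1)) (v i))) \<longrightarrow>
        (\<forall>i\<ge>1. \<forall>x. \<pi> i x = \<sigma>' (transpose (F_c x) *v gradient (v i) x)) \<longrightarrow>
        (\<forall>i\<ge>1. admissible_policy f r \<gamma> U (\<pi> (i - 1)) \<longrightarrow>
           (\<forall>x. ((\<lambda>t. \<gamma> powr t * v i (traj f (\<pi> (i - 1)) x t)) \<longlongrightarrow> 0) at_top)) \<longrightarrow>
        (\<exists>g. locally_uniform_limit (\<lambda>i. gradient (v i)) g) \<longrightarrow>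
        v_star = (\<lambda>x. SUP i\<in>{1..}. v i x) \<longrightarrow>
        \<pi>_star = (\<lambda>x. \<sigma>' (transpose (F_c x) *v gradient v_star x)) \<longrightarrow>
        (\<forall>x. bdd_above ((\<lambda>i. v i x) ` {1..})) \<and>
        (\<forall>x. attains_max (\<lambda>u. hamiltonian f r x u (gradient v_star x)) U (\<alpha> * v_star x)) \<and>
        C1_on UNIV v_star \<and>
        locally_uniform_limit v v_star \<and>
        locally_uniform_limit (\<lambda>i. gradient (v i)) (gradient v_star) \<and>
        locally_uniform_limit \<pi> \<pi>_star)"
proof -
  interpret input_affine_problem U A f r \<gamma> r_max \<phi> c f_d F_c r_0
  proof
    show "r x u \<le> r_max" if "u \<in> U" for x u
      using assms(8) that by (auto simp: attains_max_def)
  qed (use assms in blast)+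
  have \<sigma>': "\<sigma>' (transpose (F_c x) *v p) = greedy_action x p" for x p
    by (simp add: assms(24,25) greedy_action_def best_action_def cost_gradient_inv_def)
  show ?thesis
    unfolding \<sigma>' assms(7)
  proof (rule conjI; intro allI impI)
    fix \<pi>
    assume "admissible_policy f r \<gamma> U \<pi>"
    then show "maximal_policy f r \<gamma> U \<pi> (\<lambda>x. greedy_action x (gradient (value_fn f r \<gamma> \<pi>) x))"
      by (rule maximal_policy_greedy_action)
  next
    fix v \<pi> v_star \<pi>_star
    assume PI: "admissible_policy f r \<gamma> U (\<pi> 0)"
      "(\<forall>i\<ge>1. dpi_evaluation f r \<gamma> (\<pi> (i - 1)) (v i)) \<or>
        (\<exists>\<eta>>0. \<forall>i\<ge>1. ipi_evaluation f r \<gamma> \<eta> (\<pi> (i - 1)) (v i))"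
      and improve: "\<forall>i\<ge>1. \<forall>x. \<pi> i x = greedy_action x (gradient (v i) x)"
      and boundary: "\<forall>i\<ge>1. admissible_policy f r \<gamma> U (\<pi> (i - 1)) \<longrightarrow>
        (\<forall>x. ((\<lambda>t. \<gamma> powr t * v i (traj f (\<pi> (i - 1)) x t)) \<longlongrightarrow> 0) at_top)"
      and grad: "\<exists>g. locally_uniform_limit (\<lambda>i. gradient (v i)) g"
      and v_star: "v_star = (\<lambda>x. SUP i\<in>{1..}. v i x)"
      and \<pi>_star: "\<pi>_star = (\<lambda>x. greedy_action x (gradient v_star x))"
    obtain g where g: "locally_uniform_limit (\<lambda>i. gradient (v i)) g"
      using grad by blast
    have improve': "\<pi> i = (\<lambda>x. greedy_action x (gradient (v i) x))" if "1 \<le> i" for i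
      using improve that by blast
    have boundary': "((\<lambda>t. \<gamma> powr t * v i (traj f (\<pi> (i - 1)) x t)) \<longlongrightarrow> 0) at_top"
      if "1 \<le> i" "admissible_policy f r \<gamma> U (\<pi> (i - 1))" for i x
      using boundary that by blast
    note conv = policy_iteration_converges[OF PI improve' boundary' g]
    show "(\<forall>x. bdd_above ((\<lambda>i. v i x) ` {1..})) \<and>
      (\<forall>x. attains_max (\<lambda>u. hamiltonian f r x u (gradient v_star x)) U (- ln \<gamma> * v_star x)) \<and>
      C1_on UNIV v_star \<and>
      locally_uniform_limit v v_star \<and>
      locally_uniform_limit (\<lambda>i. gradient (v i)) (gradient v_star) \<and>
      locally_uniform_limit \<pi> \<pi>_star"
      \<comment> \<open>\<open>\<pi>_star\<close> mentions \<open>v_star\<close>, so it is expanded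
        first and both reach the form used in \<open>conv\<close>.\<close>
      unfolding \<pi>_star unfolding v_star by (intro conjI allI conv)
  qed
qed

end
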